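(* Let $(G,\textsc{mw}_{w,F},\lambda,\gamma)$ be a stochastic matching model with $R=\emptyset$ (i.e. $\gamma(i)=0$ for all $i\in V$), and assume that there exists $B\ge0$ such that $\mathbb P[-B\le U_{(j,i)}\le B]=1$ for every $(i,j)\in V^2$ with $\langle i,j\rangle\in E$. Suppose that $\lambda(I)<\lambda(E(I))$ for every independent set $I$ of $G$, and let $\pi$ be the unique invariant distribution of the queue-length process $(X_t)_{t\ge0}$. Then, for any initial state $X_0=x_0\in\mathcal X$, $$\lim_{t\to\infty}\mathbb E[\|X_t\|_\infty]=\int\|x\|_\infty\,\pi(\mathrm dx)\le\frac{\lambda(V)}{\eta}\Big(\frac12+(\check w+2B)|V|\Big),$$ where $\eta=\min\{\lambda(E(I))-\lambda(I):I\text{ an independent set of }G\}$ and $\check w=\max\{w_{(j,i)}:\langle i,j\rangle\in E\}$.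
   Context: Setting. $G=(V,E)$ is a finite, simple, undirected, connected graph; edges are written $\langle i,j\rangle$. For $A\subset V$, $E(A)=\{i\in V:\langle i,j\rangle\in E\text{ for some }j\in A\}$ and $E(i)=E(\{i\})$. An independent set is a nonempty $I\subset V$ such that $i,j\in I$ implies $\langle i,j\rangle\notin E$. Arrival rates: $\lambda=(\lambda(i))_{i\in V}$ with $\lambda(i)>0$; $\lambda(A)=\sum_{i\in A}\lambda(i)$. Rewards: $w=(w_{(j,i)})$, nonnegative numbers indexed by ordered pairs $(j,i)$ with $\langle i,j\rangle\in E$ (not assumed symmetric). Errors: $F=(F_{(j,i)})$ is a family of cumulative distribution functions, and $U_{(j,i)}$ ($\langle i,j\rangle\in E$) are mutually independent real random variables, $U_{(j,i)}$ having cdf $F_{(j,i)}$. State space: $\mathcal X=\{x\in\mathbb N_0^{V}:x(i)x(j)=0\text{ whenever }\langle i,j\rangle\in E\}$; $\mathrm{supp}(x)=\{i:x(i)>0\}$; $\delta_i$ is the $i$-th canonical vector; $\|x\|_\infty=\max_{i\in V}|x(i)|$. Model without reneging (generalized Max-Weight policy): class-$i$ items arrive according to independent Poisson processes of rate $\lambda(i)$; an arriving $j$-item that finds no stored item with class in $E(j)$ is stored; otherwise it is immediately matched (both items leave) with a stored item whose class is chosen uniformly at random in $\arg\max_{i\in E(j):x(i)>0}\big([x(i)+U_{(j,i)}]^++w_{(j,i)}\big)$, where $x$ is the current queue-length vector and the errors $U_{(j,i)}$ are drawn afresh at each arrival, independently of everything else. For $j\in V$ and $i\in E(j)$, $\nu_{x,j}(i)$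 denotes the probability that an arriving $j$-item in state $x$ is matched with an $i$-item. The queue-length process $X=(X_t)_{t\ge0}$ is the continuous-time Markov chain on $\mathcal X$ with generator $$\mathcal Lf(x)=\sum_{i\notin E(\mathrm{supp}(x))}\lambda(i)[f(x+\delta_i)-f(x)]+\sum_{i\in\mathrm{supp}(x)}\Big[\sum_{j\in E(i)}\lambda(j)\nu_{x,j}(i)\Big][f(x-\delta_i)-f(x)].$$ Under the assumption on $\lambda$ the chain is positive recurrent, so $\pi$ exists and is unique. *)

theory Defs
  imports "HOL-Probability.Probability"
begin

section \<open>Graphs\<close>

text \<open>A graph is given by its adjacency relation on a finite vertex type, so that the vertex
  set \<open>V\<close> is \<open>UNIV\<close>.\<close>

definition connected_simple_graph :: "('v \<Rightarrow> 'v \<Rightarrow> bool) \<Rightarrow> bool" where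
  "connected_simple_graph adj \<longleftrightarrow> symp adj \<and> irreflp adj \<and> (\<forall>i j. adj\<^sup>*\<^sup>* i j)"

definition nbhd :: "('v \<Rightarrow> 'v \<Rightarrow> bool) \<Rightarrow> 'v set \<Rightarrow> 'v set" where
  "nbhd adj A = {i. \<exists>j\<in>A. adj i j}"

definition independent_set :: "('v \<Rightarrow> 'v \<Rightarrow> bool) \<Rightarrow> 'v set \<Rightarrow> bool" where
  "independent_set adj I \<longleftrightarrow> I \<noteq> {} \<and> (\<forall>i\<in>I. \<forall>j\<in>I. \<not> adj i j)"

section \<open>Generalized Max-Weight matching without reneging\<close>

type_synonym 'v state = "'v \<Rightarrow> nat"

definition state_space :: "('v \<Rightarrow> 'v \<Rightarrow> bool) \<Rightarrow> 'v state set" where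
  "state_space adj = {x. \<forall>i j. adj i j \<longrightarrow> x i * x j = 0}"

definition supp :: "'v state \<Rightarrow> 'v set" where
  "supp x = {i. x i > 0}"

definition sup_norm :: "('v::finite) state \<Rightarrow> nat" where
  "sup_norm x = Max (range x)"

text \<open>In the next two definitions \<open>u\<close> is one realization of the errors. Both \<open>w\<close> and
  \<open>u\<close> are indexed by ordered pairs \<open>(j, i)\<close>: class of the arriving item first, class of the
  stored item second.\<close>

definition score ::
  "('v \<times> 'v \<Rightarrow> real) \<Rightarrow> ('v \<times> 'v \<Rightarrow> real) \<Rightarrow> 'v state \<Rightarrow> 'v \<Rightarrow> 'v \<Rightarrow> real" where
  "score w u x j i = max 0 (real (x i) + u (j, i)) + w (j, i)"

definition best_classes ::
  "('v \<Rightarrow> 'v \<Rightarrow> bool) \<Rightarrow> ('v \<times> 'v \<Rightarrow> real) \<Rightarrow> ('v \<times> 'v \<Rightarrow> real) \<Rightarrow> 'v state \<Rightarrow> 'v \<Rightarrow> 'v set" where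
  "best_classes adj w u x j =
     {i. is_arg_max (score w u x j) (\<lambda>i. i \<in> nbhd adj {j} \<and> 0 < x i) i}"

text \<open>The probability \<open>\<nu>\<^sub>x\<^sub>,\<^sub>j(i)\<close> that a \<open>j\<close>-item arriving in state \<open>x\<close> is matched with an
  \<open>i\<close>-item: the errors \<open>U\<close>, random variables on \<open>N\<close>, are drawn first, and then a class is chosen
  uniformly among the maximizers. There is no maximizer exactly when no stored item is compatible
  with \<open>j\<close>; then the item is stored and the probability is zero.\<close>

definition match_prob ::
  "('v \<Rightarrow> 'v \<Rightarrow> bool) \<Rightarrow> ('v \<times> 'v \<Rightarrow> real) \<Rightarrow> 'a measure \<Rightarrow> ('v \<times> 'v \<Rightarrow> 'a \<Rightarrow> real)
     \<Rightarrow> 'v state \<Rightarrow> 'v \<Rightarrow> 'v \<Rightarrow> real" where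
  "match_prob adj w N U x j i =
     (\<integral>\<omega>. (let A = best_classes adj w (\<lambda>e. U e \<omega>) x j
           in if A = {} then 0 else pmf (pmf_of_set A) i) \<partial>N)"

definition mw_generator ::
  "('v::finite \<Rightarrow> 'v \<Rightarrow> bool) \<Rightarrow> ('v \<Rightarrow> real) \<Rightarrow> ('v \<times> 'v \<Rightarrow> real) \<Rightarrow> 'a measure
     \<Rightarrow> ('v \<times> 'v \<Rightarrow> 'a \<Rightarrow> real) \<Rightarrow> ('v state \<Rightarrow> real) \<Rightarrow> 'v state \<Rightarrow> real" where
  "mw_generator adj lam w N U f x =
     (\<Sum>i\<in>- nbhd adj (supp x). lam i * (f (x(i := x i + 1)) - f x)) +
     (\<Sum>i\<in>supp x. (\<Sum>j\<in>nbhd adj {i}. lam j * match_prob adj w N U x j i) *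
                   (f (x(i := x i - 1)) - f x))"

definition stability_gap :: "('v::finite \<Rightarrow> 'v \<Rightarrow> bool) \<Rightarrow> ('v \<Rightarrow> real) \<Rightarrow> real" where
  "stability_gap adj lam =
     Min {sum lam (nbhd adj I) - sum lam I | I. independent_set adj I}"

definition max_reward :: "('v::finite \<Rightarrow> 'v \<Rightarrow> bool) \<Rightarrow> ('v \<times> 'v \<Rightarrow> real) \<Rightarrow> real" where
  "max_reward adj w = Max {w (j, i) | i j. adj i j}"

section \<open>Continuous-time Markov chains on a countable state space\<close>

text \<open>\<open>P t x\<close> is the law at time \<open>t \<ge> 0\<close> of the chain started at \<open>x\<close>. The generator is
  required to be the pointwise derivative of the semigroup at zero on all bounded functions; this
  is the right domain for generators with bounded total jump rates, such as \<^const>\<open>mw_generator\<close>,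
  whose total rate in every state is at most the sum of the arrival rates. Such a generator
  determines \<open>P\<close> on \<open>S\<close> uniquely.\<close>

definition transition_semigroup ::
  "'s set \<Rightarrow> (('s \<Rightarrow> real) \<Rightarrow> 's \<Rightarrow> real) \<Rightarrow> (real \<Rightarrow> 's \<Rightarrow> 's pmf) \<Rightarrow> bool" where
  "transition_semigroup S L P \<longleftrightarrow>
     (\<forall>t\<ge>0. \<forall>x\<in>S. set_pmf (P t x) \<subseteq> S) \<and>
     (\<forall>x\<in>S. P 0 x = return_pmf x) \<and>
     (\<forall>s\<ge>0. \<forall>t\<ge>0. \<forall>x\<in>S. P (s + t) x = bind_pmf (P s x) (P t)) \<and>
     (\<forall>f. bounded (f ` S) \<longrightarrow>
        (\<forall>x\<in>S. ((\<lambda>h. (measure_pmf.expectation (P h x) f - f x) / h) \<longlongrightarrow> L f x) (at_right 0)))"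

text \<open>The last two conjuncts are the Markov property with transition semigroup \<open>P\<close>, expressed by
  the finite-dimensional distributions, and almost sure right-continuity of the paths for the
  discrete topology.\<close>

definition markov_chain ::
  "'b measure \<Rightarrow> 's set \<Rightarrow> (real \<Rightarrow> 's \<Rightarrow> 's pmf) \<Rightarrow> (real \<Rightarrow> 'b \<Rightarrow> 's) \<Rightarrow> bool" where
  "markov_chain M S P X \<longleftrightarrow>
     (\<forall>t\<ge>0. X t \<in> measurable M (count_space UNIV)) \<and>
     (\<forall>t\<ge>0. \<forall>\<omega>\<in>space M. X t \<omega> \<in> S) \<and>
     (\<forall>n (t :: nat \<Rightarrow> real) x. 0 \<le> t 0 \<longrightarrow> (\<forall>k\<le>n. t k < t (Suc k)) \<longrightarrow> (\<forall>k\<le>Suc n. x k \<in> S) \<longrightarrow>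
        measure M {\<omega> \<in> space M. \<forall>k\<le>Suc n. X (t k) \<omega> = x k} =
        measure M {\<omega> \<in> space M. \<forall>k\<le>n. X (t k) \<omega> = x k} *
          pmf (P (t (Suc n) - t n) (x n)) (x (Suc n))) \<and>
     (AE \<omega> in M. \<forall>t\<ge>0. \<forall>\<^sub>F s in at_right t. X s \<omega> = X t \<omega>)"

definition invariant_distribution ::
  "'s set \<Rightarrow> (real \<Rightarrow> 's \<Rightarrow> 's pmf) \<Rightarrow> 's pmf \<Rightarrow> bool" where
  "invariant_distribution S P \<pi> \<longleftrightarrow> set_pmf \<pi> \<subseteq> S \<and> (\<forall>t\<ge>0. bind_pmf \<pi> (P t) = \<pi>)"

end

theory Submission
  imports Defs
begin

text \<open>The energy \<open>\<Sum>\<^sub>i x(i)\<^sup>2\<close> is a Lyapunov function. Decomposing the queue lengths into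
  the level sets \<open>{i. x(i) > m}\<close>, \<open>m < \<parallel>x\<parallel>\<close>, which are independent sets, and using that the
  matched class is within \<open>max_reward + 2B\<close> of the longest compatible queue, the generator decreases
  it at rate at least \<open>2\<eta>\<parallel>x\<parallel>\<close>, up to a constant. Applying the generator to the bounded functions
  \<open>min(energy, n)\<close>, whose drift has zero stationary mean, gives the bound on the mean under \<open>\<pi>\<close>
  without any integrability assumption.

  Convergence in total variation follows from a contraction argument: every state leads to the empty
  one, so as long as the positive and the negative part of \<open>P\<^sub>n(x\<^sub>0, \<cdot>) - \<pi>\<close> carry a given mass, one
  step cancels a fixed amount of it in the empty state. Since \<open>\<pi>\<close> is invariant,
  \<open>P\<^sub>t(x\<^sub>0, \<cdot>) \<le> \<pi> / \<pi>(x\<^sub>0)\<close>. This domination makes the contraction uniform and turns pointwise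
  convergence of the laws into convergence of the means.\<close>

section \<open>Transition probabilities and stationarity\<close>

text \<open>Only the contribution of the one intermediate state \<open>y\<close> is kept.\<close>

lemma pmf_bind_ge: "pmf (bind_pmf p K) z \<ge> pmf p y * pmf (K y) z"
proof -
  have "pmf p y * pmf (K y) z = (\<integral>x. indicator {y} x * pmf (K y) z \<partial>measure_pmf p)"
    by (simp add: measure_pmf_single)
  also have "\<dots> \<le> (\<integral>x. pmf (K x) z \<partial>measure_pmf p)"
  proof (rule integral_mono)
    show "integrable (measure_pmf p) (\<lambda>x. pmf (K x) z)"
      by (rule measure_pmf.integrable_const_bound[where B=1]) (auto simp: pmf_le_1)
    show "integrable (measure_pmf p) (\<lambda>x. indicator {y} x * pmf (K y) z)"
      by (rule measure_pmf.integrable_const_bound[where B=1])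
         (auto simp: pmf_le_1 split: split_indicator)
  qed (auto split: split_indicator)
  finally show ?thesis by (simp add: pmf_bind)
qed

lemma expectation_indicator_single: "measure_pmf.expectation p (indicator {y}) = pmf p y"
  by (simp add: measure_pmf_single)

text \<open>The integrand \<open>g y - g x\<close> vanishes at \<open>y = x\<close> and is at most
  \<open>2 * C\<close> elsewhere, so only the mass away from \<open>x\<close> counts.\<close>

lemma abs_expectation_diff_le:
  fixes g :: "'s \<Rightarrow> real"
  assumes g: "\<And>y. \<bar>g y\<bar> \<le> C"
  shows "\<bar>measure_pmf.expectation p g - g x\<bar> \<le> 2 * C * (1 - pmf p x)"
proof -
  have int: "integrable (measure_pmf p) g"
    using g by (intro measure_pmf.integrable_const_bound[where B=C]) auto
  have "\<bar>measure_pmf.expectation p g - g x\<bar> = \<bar>\<integral>y. g y - g x \<partial>measure_pmf p\<bar>"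
    using int by simp
  also have "\<dots> \<le> (\<integral>y. \<bar>g y - g x\<bar> \<partial>measure_pmf p)"
    by (rule integral_abs_bound)
  also have "\<dots> \<le> (\<integral>y. 2 * C * (1 - indicator {x} y) \<partial>measure_pmf p)"
  proof (rule integral_mono)
    show "integrable (measure_pmf p) (\<lambda>y. \<bar>g y - g x\<bar>)"
      using int by auto
    show "integrable (measure_pmf p) (\<lambda>y. 2 * C * (1 - indicator {x} y))"
      by (intro measure_pmf.integrable_const_bound[where B="2 * \<bar>C\<bar>"])
         (auto split: split_indicator)
    fix y
    show "\<bar>g y - g x\<bar> \<le> 2 * C * (1 - indicator {x} y)"
      using g[of x] g[of y] by (auto split: split_indicator)
  qed
  also have "\<dots> = 2 * C * (1 - pmf p x)"
    using measure_pmf.integrable_const_bound[where B=1 and f="indicator {x} :: _ \<Rightarrow> real" and M=p]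
    by (simp add: measure_pmf_single)
  finally show ?thesis .
qed

lemma expectation_bind_pmf:
  fixes g :: "'s \<Rightarrow> real"
  assumes g: "\<And>y. \<bar>g y\<bar> \<le> C"
  shows "measure_pmf.expectation (bind_pmf p K) g =
    measure_pmf.expectation p (\<lambda>x. measure_pmf.expectation (K x) g)"
  unfolding measure_pmf_bind
  by (rule integral_bind[where K="count_space UNIV" and B=C and B'=1])
     (use g measurable_measure_pmf[of K] in \<open>auto simp: measure_pmf.emeasure_le_1\<close>)

text \<open>\<open>- L (indicator {x}) x\<close> is the rate at which mass leaves \<open>x\<close>,
  so \<Lambda> bounds the exit rates uniformly over \<open>S\<close>.\<close>

locale markov_semigroup =
  fixes S :: "'s set" and L and P and \<Lambda> :: real
  assumes semigroup: "transition_semigroup S L P"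
    and exit_rate: "\<And>x. x \<in> S \<Longrightarrow> - L (indicator {x}) x \<le> \<Lambda>"
begin

lemma P_in: "t \<ge> 0 \<Longrightarrow> x \<in> S \<Longrightarrow> set_pmf (P t x) \<subseteq> S"
  and P_0: "x \<in> S \<Longrightarrow> P 0 x = return_pmf x"
  and P_add: "s \<ge> 0 \<Longrightarrow> t \<ge> 0 \<Longrightarrow> x \<in> S \<Longrightarrow> P (s + t) x = bind_pmf (P s x) (P t)"
  and generator: "bounded (f ` S) \<Longrightarrow> x \<in> S \<Longrightarrow>
    ((\<lambda>h. (measure_pmf.expectation (P h x) f - f x) / h) \<longlongrightarrow> L f x) (at_right 0)"
  using semigroup unfolding transition_semigroup_def by blast+

lemma generator_indicator:
  assumes "x \<in> S"
  shows "((\<lambda>h. (pmf (P h x) y - indicator {y} x) / h) \<longlongrightarrow> L (indicator {y}) x) (at_right 0)"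
proof -
  have "bounded (indicator {y} ` S :: real set)"
    by (rule boundedI[where B=1]) auto
  from generator[OF this assms] show ?thesis
    by (simp only: expectation_indicator_single)
qed

text \<open>The grid \<open>t / real (Suc n)\<close> serves two purposes: dominated convergence runs
  along a sequence, and the Bernoulli argument cuts \<open>t\<close> into equal pieces. The
  successor avoids division by zero.\<close>

lemma generator_sequentially:
  assumes "bounded (f ` S)" "x \<in> S" "t > 0"
  shows "(\<lambda>n. (measure_pmf.expectation (P (t / real (Suc n)) x) f - f x) / (t / real (Suc n)))
    \<longlonglongrightarrow> L f x"
proof -
  have "filterlim (\<lambda>n. t / real (Suc n)) (at_right 0) sequentially"
    unfolding filterlim_at using \<open>t > 0\<close> lim_const_over_n[of t, THEN LIMSEQ_Suc]
    by (auto simp: eventually_sequentially)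
  from filterlim_compose[OF generator[OF assms(1,2)] this] show ?thesis .
qed

text \<open>Being at \<open>x\<close> at every multiple of \<open>h\<close> is one way to be there
  at the end.\<close>

lemma P_self_power:
  assumes "x \<in> S" "h \<ge> 0"
  shows "pmf (P (real n * h) x) x \<ge> pmf (P h x) x ^ n"
proof (induction n)
  case 0
  then show ?case using assms by (simp add: P_0)
next
  case (Suc n)
  have "pmf (P h x) x ^ Suc n \<le> pmf (P h x) x * pmf (P (real n * h) x) x"
    using Suc by (simp add: mult_left_mono)
  also have "\<dots> \<le> pmf (P (h + real n * h) x) x"
    using assms pmf_bind_ge by (simp add: P_add)
  finally show ?case by (simp add: algebra_simps)
qed

text \<open>By Bernoulli's inequality, \<open>P\<^sub>t(x, x) \<ge> P\<^sub>t\<^sub>/\<^sub>n(x, x)\<^sup>n \<ge> 1 - n (1 - P\<^sub>t\<^sub>/\<^sub>n(x, x))\<close>, and the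
  right-hand side is controlled by the derivative at zero. This makes difference quotients of bounded
  functions bounded uniformly in the state.\<close>

lemma P_self_ge:
  assumes "x \<in> S" "t \<ge> 0"
  shows "pmf (P t x) x \<ge> 1 - \<Lambda> * t"
proof (cases "t = 0")
  case True
  then show ?thesis using assms by (simp add: P_0)
next
  case False
  with assms have t: "t > 0" by simp
  define p where "p n = pmf (P (t / real (Suc n)) x) x" for n
  have b: "bounded (indicator {x} ` S :: real set)"
    by (rule boundedI[where B=1]) auto
  have "(\<lambda>n. (p n - 1) / (t / real (Suc n))) \<longlonglongrightarrow> L (indicator {x}) x"
    using generator_sequentially[OF b \<open>x \<in> S\<close> t]
    by (simp only: expectation_indicator_single p_def) simp
  from tendsto_mult_left[OF this, of t]
  have lim: "(\<lambda>n. 1 + real (Suc n) * (p n - 1)) \<longlonglongrightarrow> 1 + t * L (indicator {x}) x"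
    using t by (intro tendsto_add tendsto_const) (simp add: mult.commute)
  have "1 + real (Suc n) * (p n - 1) \<le> pmf (P t x) x" for n
  proof -
    have "1 + real (Suc n) * (p n - 1) \<le> (1 + (p n - 1)) ^ Suc n"
      by (rule Bernoulli_inequality) (simp add: p_def)
    also have "\<dots> \<le> pmf (P (real (Suc n) * (t / real (Suc n))) x) x"
      using P_self_power[of x "t / real (Suc n)" "Suc n"] assms by (simp add: p_def)
    finally show ?thesis by simp
  qed
  with lim have "1 + t * L (indicator {x}) x \<le> pmf (P t x) x"
    by (intro LIMSEQ_le_const2) auto
  moreover have "t * (- L (indicator {x}) x) \<le> t * \<Lambda>"
    using exit_rate[OF \<open>x \<in> S\<close>] t by (intro mult_left_mono) auto
  ultimately show ?thesis by (simp add: mult.commute)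
qed

text \<open>The linear bound \<open>P_self_ge\<close> may be negative for large \<open>t\<close>.
  Hence \<open>t\<close> is cut into pieces so short that \<Lambda> times their length is below 1,
  and the probabilities are multiplied.\<close>

lemma P_self_pos:
  assumes "x \<in> S" "t \<ge> 0"
  shows "pmf (P t x) x > 0"
proof -
  obtain n :: nat where "real n > \<Lambda> * t"
    using reals_Archimedean2 by blast
  then have "\<Lambda> * (t / real (Suc n)) < 1"
    by (simp add: field_simps)
  moreover have "1 - \<Lambda> * (t / real (Suc n)) \<le> pmf (P (t / real (Suc n)) x) x"
    using assms by (intro P_self_ge) auto
  ultimately have "pmf (P (t / real (Suc n)) x) x > 0"
    by linarith
  then have "0 < pmf (P (t / real (Suc n)) x) x ^ Suc n" by simp
  also have "\<dots> \<le> pmf (P (real (Suc n) * (t / real (Suc n))) x) x"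
    using assms by (intro P_self_power) auto
  finally show ?thesis by simp
qed

lemma P_pos_trans:
  assumes "x \<in> S" "s \<ge> 0" "t \<ge> 0" "pmf (P s x) y > 0" "pmf (P t y) z > 0"
  shows "pmf (P (s + t) x) z > 0"
proof -
  have "0 < pmf (P s x) y * pmf (P t y) z" using assms by simp
  also have "\<dots> \<le> pmf (P (s + t) x) z"
    using assms pmf_bind_ge by (simp add: P_add)
  finally show ?thesis .
qed

text \<open>A positive derivative at zero gives positivity at some time \<open>h < t\<close>;
  staying at \<open>y\<close> for the remaining time \<open>t - h\<close> extends it to
  \<open>t\<close>.\<close>

lemma P_pos:
  assumes x: "x \<in> S" and y: "y \<in> S" and rate: "L (indicator {y}) x > 0" and ne: "x \<noteq> y" and t: "t > 0"
  shows "pmf (P t x) y > 0"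
proof -
  have "\<forall>\<^sub>F h in at_right 0. (pmf (P h x) y - indicator {y} x) / h > 0"
    using order_tendstoD(1)[OF generator_indicator[OF x] rate] .
  moreover have "\<forall>\<^sub>F h in at_right 0. h < t" "\<forall>\<^sub>F h in at_right 0. h > (0::real)"
    using t by (auto intro: eventually_at_right_less order_tendstoD)
  ultimately have "\<forall>\<^sub>F h in at_right 0. pmf (P h x) y > 0 \<and> h < t \<and> 0 < h"
    by eventually_elim (use ne in \<open>auto simp: zero_less_divide_iff\<close>)
  then obtain h where h: "pmf (P h x) y > 0" "h < t" "0 < h"
    using eventually_happens'[OF trivial_limit_at_right_real] by blast
  then have "pmf (P (h + (t - h)) x) y > 0"
    using P_pos_trans[of x h "t - h" y y] P_self_pos[of y "t - h"] x y by simp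
  then show ?thesis by simp
qed

text \<open>Half of the time is spent on the path up to its last jump and half on that jump, hence
  the induction over arbitrary \<open>t\<close>. Since every positive time works, the chain sampled
  at integer times has no periodicity.\<close>

lemma P_pos_rtrancl:
  assumes path: "(\<lambda>x y. x \<in> S \<and> y \<in> S \<and> x \<noteq> y \<and> L (indicator {y}) x > 0)\<^sup>*\<^sup>* x y"
    and x: "x \<in> S" and t: "t > 0"
  shows "pmf (P t x) y > 0"
  using path t
proof (induction arbitrary: t)
  case base
  then show ?case using x P_self_pos by simp
next
  case (step y z)
  have "pmf (P (t / 2 + t / 2) x) z > 0"
    by (rule P_pos_trans[OF x _ _ step.IH P_pos]) (use step in auto)
  then show ?case by simp
qed

end

section \<open>Stationary means of the generator and the drift criterion\<close>

locale stationary_markov_semigroup = markov_semigroup +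
  fixes \<pi> :: "'a pmf"
  assumes invariant: "invariant_distribution S P \<pi>"
begin

lemma set_\<pi>: "set_pmf \<pi> \<subseteq> S"
  and bind_\<pi>: "t \<ge> 0 \<Longrightarrow> bind_pmf \<pi> (P t) = \<pi>"
  using invariant by (auto simp: invariant_distribution_def)

text \<open>By invariance the difference quotients of \<open>g\<close> have stationary mean zero. By
  \<open>P_self_ge\<close> they are bounded by \<open>2 * C * \<Lambda>\<close> in every state of
  \<open>S\<close>, so dominated convergence passes this on to their limit
  \<open>L g\<close>.\<close>

lemma expectation_generator:
  assumes g: "\<And>y. \<bar>g y\<bar> \<le> C"
  shows "integrable (measure_pmf \<pi>) (L g)" "measure_pmf.expectation \<pi> (L g) = 0"
proof -
  define h where "h n = 1 / real (Suc n)" for n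
  define s where "s n x = (measure_pmf.expectation (P (h n) x) g - g x) / h n" for n x
  have h: "h n > 0" for n by (simp add: h_def)
  have b: "bounded (g ` S)"
    using g by (intro boundedI[where B=C]) auto
  have C: "C \<ge> 0" using g[of undefined] by linarith
  have lim: "AE x in measure_pmf \<pi>. (\<lambda>n. s n x) \<longlonglongrightarrow> L g x"
    using generator_sequentially[OF b, of _ 1] set_\<pi>
    by (auto simp: AE_measure_pmf_iff s_def h_def)
  have bound: "AE x in measure_pmf \<pi>. norm (s n x) \<le> 2 * C * \<Lambda>" for n
  proof -
    have "norm (s n x) \<le> 2 * C * \<Lambda>" if "x \<in> S" for x
    proof -
      have "\<bar>measure_pmf.expectation (P (h n) x) g - g x\<bar> \<le> 2 * C * (1 - pmf (P (h n) x) x)"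
        by (rule abs_expectation_diff_le[OF g])
      also have "\<dots> \<le> 2 * C * (\<Lambda> * h n)"
        using P_self_ge[OF that, of "h n"] h[of n] C by (intro mult_left_mono) auto
      finally show ?thesis
        using h[of n] by (simp add: s_def field_simps)
    qed
    then show ?thesis using set_\<pi> by (auto simp: AE_measure_pmf_iff)
  qed
  have zero: "measure_pmf.expectation \<pi> (s n) = 0" for n
  proof -
    have "integrable (measure_pmf \<pi>) g"
      using g by (intro measure_pmf.integrable_const_bound[where B=C]) auto
    moreover have "\<bar>measure_pmf.expectation p g\<bar> \<le> C" for p
    proof -
      have "\<bar>measure_pmf.expectation p g\<bar> \<le> (\<integral>x. \<bar>g x\<bar> \<partial>measure_pmf p)"
        by (rule integral_abs_bound)
      also have "\<dots> \<le> C"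
        using g by (intro measure_pmf.integral_le_const measure_pmf.integrable_const_bound[where B=C]) auto
      finally show ?thesis .
    qed
    then have "integrable (measure_pmf \<pi>) (\<lambda>x. measure_pmf.expectation (P (h n) x) g)"
      by (intro measure_pmf.integrable_const_bound[where B=C]) auto
    ultimately have "measure_pmf.expectation \<pi> (s n) =
      (measure_pmf.expectation (bind_pmf \<pi> (P (h n))) g - measure_pmf.expectation \<pi> g) / h n"
      by (simp add: s_def[abs_def] expectation_bind_pmf[OF g])
    then show ?thesis
      using h[of n] by (simp add: bind_\<pi>)
  qed
  show "integrable (measure_pmf \<pi>) (L g)"
    by (rule integrable_dominated_convergence[OF _ _ _ lim bound]) auto
  have "(\<lambda>n. measure_pmf.expectation \<pi> (s n)) \<longlonglongrightarrow> measure_pmf.expectation \<pi> (L g)"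
    by (rule integral_dominated_convergence[OF _ _ _ lim bound]) auto
  then show "measure_pmf.expectation \<pi> (L g) = 0"
    by (simp add: zero LIMSEQ_const_iff)
qed

text \<open>The Foster-Lyapunov bound for a function \<open>V\<close> that may fail to be
  integrable: the truncations of \<open>V\<close> are bounded, hence have zero mean drift, which
  bounds the mean of \<open>f\<close> on \<open>{x. V x < real n}\<close>. Fatou's lemma lets
  \<open>n\<close> tend to infinity.\<close>

lemma expectation_le_of_drift:
  fixes V f :: "'a \<Rightarrow> real"
  assumes V: "\<And>x. 0 \<le> V x" and f: "\<And>x. 0 \<le> f x" "\<And>x. f x \<le> V x"
    and b: "b \<ge> 0" and c: "c > 0"
    and drift: "\<And>n x. x \<in> S \<Longrightarrow>
      L (\<lambda>y. min (V y) (real n)) x \<le> (if V x < real n then b - c * f x else 0)"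
  shows "(\<integral>\<^sup>+x. ennreal (f x) \<partial>measure_pmf \<pi>) \<le> ennreal (b / c)"
proof -
  define f' where "f' n x = f x * indicator {x. V x < real n} x" for n x
  have f'_bound: "0 \<le> f' n x" "f' n x \<le> real n" for n x
    using f[of x] by (auto simp: f'_def split: split_indicator)
  have int: "integrable (measure_pmf \<pi>) (f' n)" for n
    using f'_bound by (intro measure_pmf.integrable_const_bound[where B="real n"]) auto
  have "measure_pmf.expectation \<pi> (f' n) \<le> b / c" for n
  proof -
    let ?g = "\<lambda>y. min (V y) (real n)"
    have g: "\<bar>?g y\<bar> \<le> real n" for y using V[of y] by auto
    have "0 = measure_pmf.expectation \<pi> (L ?g)"
      by (rule expectation_generator(2)[OF g, symmetric])
    also have "\<dots> \<le> measure_pmf.expectation \<pi> (\<lambda>x. b - c * f' n x)"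
    proof (rule integral_mono_AE)
      show "integrable (measure_pmf \<pi>) (L ?g)"
        by (rule expectation_generator(1)[OF g])
      \<comment> \<open>Where \<open>V x\<close> is at least \<open>n\<close>, the function
        \<open>f'\<close> vanishes and the right-hand side is \<open>b\<close>, which is
        nonnegative; there a nonpositive drift suffices.\<close>
      have "L ?g x \<le> b - c * f' n x" if "x \<in> S" for x
        using drift[OF that, of n] b by (auto simp: f'_def split: if_splits)
      then show "AE x in measure_pmf \<pi>. L ?g x \<le> b - c * f' n x"
        using set_\<pi> by (auto simp: AE_measure_pmf_iff)
    qed (use int in auto)
    also have "\<dots> = b - c * measure_pmf.expectation \<pi> (f' n)"
      using int by simp
    finally show ?thesis using c by (simp add: field_simps)
  qed
  then have le: "(\<integral>\<^sup>+x. ennreal (f' n x) \<partial>measure_pmf \<pi>) \<le> ennreal (b / c)" for n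
    using int f'_bound by (subst nn_integral_eq_integral) (auto intro: ennreal_leI)
  have lim: "(\<lambda>n. ennreal (f' n x)) \<longlonglongrightarrow> ennreal (f x)" for x
  proof (rule tendsto_eventually)
    obtain m :: nat where "V x < real m" using reals_Archimedean2 by blast
    then show "\<forall>\<^sub>F n in sequentially. ennreal (f' n x) = ennreal (f x)"
      unfolding eventually_sequentially f'_def by (intro exI[of _ m]) auto
  qed
  have "(\<integral>\<^sup>+x. ennreal (f x) \<partial>measure_pmf \<pi>) =
    (\<integral>\<^sup>+x. liminf (\<lambda>n. ennreal (f' n x)) \<partial>measure_pmf \<pi>)"
    by (simp add: lim_imp_Liminf[OF _ lim])
  also have "\<dots> \<le> liminf (\<lambda>n. \<integral>\<^sup>+x. ennreal (f' n x) \<partial>measure_pmf \<pi>)"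
    by (rule nn_integral_liminf) auto
  also have "\<dots> \<le> ennreal (b / c)"
    using le by (intro Liminf_le) auto
  finally show ?thesis .
qed

end

section \<open>Convergence to equilibrium\<close>

text \<open>Since \<^const>\<open>ennreal\<close> truncates negative numbers to zero, this is the mass of the positive part
  of the signed measure \<open>p - q\<close>, that is, the total variation distance.\<close>

definition excess :: "'s pmf \<Rightarrow> 's pmf \<Rightarrow> ennreal" where
  "excess p q = (\<integral>\<^sup>+y. ennreal (pmf p y - pmf q y) \<partial>count_space UNIV)"

lemma nn_integral_pmf_UNIV: "(\<integral>\<^sup>+y. ennreal (pmf p y) \<partial>count_space UNIV) = 1"
  by (simp add: nn_integral_pmf measure_pmf.emeasure_space_1[simplified])

lemma excess_le_1: "excess p q \<le> 1"
proof -
  have "excess p q \<le> (\<integral>\<^sup>+y. ennreal (pmf p y) \<partial>count_space UNIV)"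
    unfolding excess_def by (intro nn_integral_mono ennreal_leI) simp
  then show ?thesis by (simp add: nn_integral_pmf_UNIV)
qed

text \<open>Adding the common mass \<open>m\<close> to either excess gives total mass 1. Since
  \<open>m\<close> is finite, it can be cancelled in \<open>ennreal\<close>.\<close>

lemma excess_commute: "excess p q = excess q p"
proof -
  define m where "m = (\<integral>\<^sup>+y. ennreal (min (pmf p y) (pmf q y)) \<partial>count_space UNIV)"
  have m: "m \<le> 1"
    unfolding m_def nn_integral_pmf_UNIV[of p, symmetric] by (intro nn_integral_mono ennreal_leI) simp
  have "m + excess p q = (\<integral>\<^sup>+y. ennreal (pmf p y) \<partial>count_space UNIV)"
    unfolding m_def excess_def
    by (subst nn_integral_add[symmetric]) (auto intro!: nn_integral_cong simp: min_def ennreal_neg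
      simp flip: ennreal_plus)
  moreover have "m + excess q p = (\<integral>\<^sup>+y. ennreal (pmf q y) \<partial>count_space UNIV)"
    unfolding m_def excess_def
    by (subst nn_integral_add[symmetric]) (auto intro!: nn_integral_cong simp: min_def ennreal_neg
      simp flip: ennreal_plus)
  ultimately have "m + excess p q = m + excess q p"
    by (simp only: nn_integral_pmf_UNIV)
  then show ?thesis
    using m by (subst (asm) ennreal_add_left_cancel) (auto simp: top_unique)
qed

lemma pmf_diff_le_excess: "ennreal (pmf p y - pmf q y) \<le> excess p q"
proof -
  have "ennreal (pmf p y - pmf q y) =
    (\<integral>\<^sup>+z. ennreal (pmf p z - pmf q z) * indicator {y} z \<partial>count_space UNIV)"
    by (simp add: nn_integral_count_space_indicator[symmetric] nn_integral_count_space_finite)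
  also have "\<dots> \<le> excess p q"
    unfolding excess_def by (intro nn_integral_mono) (auto split: split_indicator)
  finally show ?thesis .
qed

text \<open>The mass that one step of the kernel \<open>K\<close> moves from the positive part of \<open>p - q\<close> to \<open>y\<close>.\<close>

definition excess_flow :: "'s pmf \<Rightarrow> 's pmf \<Rightarrow> ('s \<Rightarrow> 't pmf) \<Rightarrow> 't \<Rightarrow> ennreal" where
  "excess_flow p q K y =
    (\<integral>\<^sup>+x. ennreal (pmf p x - pmf q x) * ennreal (pmf (K x) y) \<partial>count_space UNIV)"

text \<open>Tonelli: each \<open>K x\<close> has total mass 1, so the positive part is transported
  without loss.\<close>

lemma nn_integral_excess_flow:
  "(\<integral>\<^sup>+y. excess_flow p q K y \<partial>count_space UNIV) = excess p q"
proof -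
  have "(\<integral>\<^sup>+y. excess_flow p q K y \<partial>count_space UNIV) =
    (\<integral>\<^sup>+x. \<integral>\<^sup>+y. ennreal (pmf p x - pmf q x) * ennreal (pmf (K x) y) \<partial>count_space UNIV \<partial>count_space UNIV)"
    unfolding excess_flow_def
    using nn_integral_fst_count_space[of "\<lambda>(x, y). ennreal (pmf p x - pmf q x) * ennreal (pmf (K x) y)"]
      nn_integral_snd_count_space[of "\<lambda>(x, y). ennreal (pmf p x - pmf q x) * ennreal (pmf (K x) y)"]
    by simp
  also have "\<dots> = excess p q"
    by (simp add: nn_integral_cmult nn_integral_pmf_UNIV excess_def)
  finally show ?thesis .
qed

lemma ennreal_pmf_bind_count_space:
  "ennreal (pmf (bind_pmf p K) y) =
    (\<integral>\<^sup>+x. ennreal (pmf p x) * ennreal (pmf (K x) y) \<partial>count_space UNIV)"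
  by (simp add: ennreal_pmf_bind nn_integral_measure_pmf)

text \<open>This says that the new difference at \<open>y\<close> is the flow from the positive part
  minus the flow from the negative part. It is written with sums because subtraction in
  \<open>ennreal\<close> truncates.\<close>

lemma pmf_bind_add_excess_flow:
  "ennreal (pmf (bind_pmf p K) y) + excess_flow q p K y =
   ennreal (pmf (bind_pmf q K) y) + excess_flow p q K y"
proof -
  have "ennreal (pmf p x) * ennreal (pmf (K x) y) + ennreal (pmf q x - pmf p x) * ennreal (pmf (K x) y) =
    ennreal (pmf q x) * ennreal (pmf (K x) y) + ennreal (pmf p x - pmf q x) * ennreal (pmf (K x) y)" for x
  proof -
    have "ennreal (pmf p x) + ennreal (pmf q x - pmf p x) = ennreal (pmf q x) + ennreal (pmf p x - pmf q x)"
      by (cases "pmf p x \<le> pmf q x") (simp_all add: ennreal_neg flip: ennreal_plus)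
    then show ?thesis by (simp flip: distrib_right)
  qed
  then show ?thesis
    unfolding ennreal_pmf_bind_count_space excess_flow_def
    by (simp add: nn_integral_add[symmetric])
qed

lemma excess_flow_le_1: "excess_flow p q K y \<le> 1"
proof -
  have "excess_flow p q K y \<le> excess p q"
    unfolding excess_def excess_flow_def
    by (intro nn_integral_mono) (simp add: mult_left_le pmf_le_1)
  then show ?thesis using excess_le_1 order_trans by blast
qed

text \<open>With \<open>a\<close> and \<open>b\<close> for the two flows into \<open>y\<close>, this
  is the identity \<open>max 0 (a - b) + min a b = a\<close>; the minimum is the mass that cancels
  at \<open>y\<close>.\<close>

lemma pmf_bind_diff_add_min_excess_flow:
  "ennreal (pmf (bind_pmf p K) y - pmf (bind_pmf q K) y) +
    min (excess_flow p q K y) (excess_flow q p K y) = excess_flow p q K y"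
proof -
  have fin: "excess_flow p q K y \<noteq> \<top>" "excess_flow q p K y \<noteq> \<top>"
    using excess_flow_le_1[of p q K y] excess_flow_le_1[of q p K y] by (auto simp: top_unique)
  define a b where "a = enn2real (excess_flow p q K y)" and "b = enn2real (excess_flow q p K y)"
  have nn: "a \<ge> 0" "b \<ge> 0" by (simp_all add: a_def b_def)
  have a: "excess_flow p q K y = ennreal a" and b: "excess_flow q p K y = ennreal b"
    using fin by (simp_all add: a_def b_def less_top)
  have "pmf (bind_pmf p K) y + b = pmf (bind_pmf q K) y + a"
    using pmf_bind_add_excess_flow[of p K y q] nn unfolding a b
    by (simp flip: ennreal_plus)
  then have "pmf (bind_pmf p K) y - pmf (bind_pmf q K) y = a - b" by simp
  with nn show ?thesis unfolding a b
    by (cases "a \<le> b") (simp_all add: min_def ennreal_neg flip: ennreal_plus)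
qed

text \<open>Summing the previous identity over all target states gives equality with the total
  cancelled mass; of that mass only the part at \<open>y\<close> is kept.\<close>

lemma excess_bind_le:
  "excess (bind_pmf p K) (bind_pmf q K) + min (excess_flow p q K y) (excess_flow q p K y) \<le> excess p q"
proof -
  let ?m = "\<lambda>y. min (excess_flow p q K y) (excess_flow q p K y)"
  have "?m y = (\<integral>\<^sup>+z. ?m z * indicator {y} z \<partial>count_space UNIV)"
    by (simp add: nn_integral_count_space_indicator[symmetric] nn_integral_count_space_finite)
  also have "\<dots> \<le> (\<integral>\<^sup>+z. ?m z \<partial>count_space UNIV)"
    by (intro nn_integral_mono) (auto split: split_indicator)
  finally have "excess (bind_pmf p K) (bind_pmf q K) + ?m y \<le>
    excess (bind_pmf p K) (bind_pmf q K) + (\<integral>\<^sup>+z. ?m z \<partial>count_space UNIV)"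
    by (rule add_left_mono)
  also have "\<dots> = (\<integral>\<^sup>+z. ennreal (pmf (bind_pmf p K) z - pmf (bind_pmf q K) z) + ?m z \<partial>count_space UNIV)"
    unfolding excess_def by (simp add: nn_integral_add)
  also have "\<dots> = excess p q"
    by (simp only: pmf_bind_diff_add_min_excess_flow nn_integral_excess_flow)
  finally show ?thesis .
qed

lemma excess_bind_mono: "excess (bind_pmf p K) (bind_pmf q K) \<le> excess p q"
  using excess_bind_le[of p K q undefined] by (meson add_increasing2 order_trans zero_le order_refl)

text \<open>States in \<open>A\<close> send at least a fraction \<delta> of their mass to
  \<open>y\<close>; outside \<open>A\<close> the domination by \<open>C * pmf r x\<close> bounds the
  mass that is lost in the estimate.\<close>

lemma excess_le_excess_flow:
  assumes \<delta>: "\<And>x. x \<in> A \<Longrightarrow> \<delta> \<le> pmf (K x) y" "\<delta> \<ge> 0"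
    and dom: "\<And>x. pmf p x \<le> C * pmf r x" and C: "C \<ge> 0"
  shows "ennreal \<delta> * excess p q \<le> excess_flow p q K y + ennreal (\<delta> * C * measure_pmf.prob r (- A))"
proof -
  have "ennreal \<delta> * ennreal (pmf p x - pmf q x) \<le>
    ennreal (pmf p x - pmf q x) * ennreal (pmf (K x) y) + ennreal (\<delta> * C) * (ennreal (pmf r x) * indicator (- A) x)" for x
  proof (cases "x \<in> A")
    case True
    have "ennreal \<delta> * ennreal (pmf p x - pmf q x) \<le> ennreal (pmf p x - pmf q x) * ennreal (pmf (K x) y)"
      unfolding mult.commute[of "ennreal \<delta>"]
      using \<delta>(1)[OF True] by (intro mult_left_mono ennreal_leI) auto
    then show ?thesis using True by simp
  next
    case False
    have "pmf p x - pmf q x \<le> C * pmf r x"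
      using dom[of x] pmf_nonneg[of q x] by linarith
    then have "ennreal \<delta> * ennreal (pmf p x - pmf q x) \<le> ennreal \<delta> * ennreal (C * pmf r x)"
      by (intro mult_left_mono ennreal_leI) auto
    also have "\<dots> = ennreal (\<delta> * C) * (ennreal (pmf r x) * indicator (- A) x)"
      using False C \<delta>(2) by (simp add: ennreal_mult mult.assoc)
    finally show ?thesis by (rule order_trans) simp
  qed
  then have "(\<integral>\<^sup>+x. ennreal \<delta> * ennreal (pmf p x - pmf q x) \<partial>count_space UNIV) \<le>
    (\<integral>\<^sup>+x. ennreal (pmf p x - pmf q x) * ennreal (pmf (K x) y) +
      ennreal (\<delta> * C) * (ennreal (pmf r x) * indicator (- A) x) \<partial>count_space UNIV)"
    by (rule nn_integral_mono)
  also have "\<dots> = excess_flow p q K y + ennreal (\<delta> * C) * emeasure r (- A)"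
    by (simp add: nn_integral_add nn_integral_cmult excess_flow_def nn_integral_count_space_indicator[symmetric]
      nn_integral_pmf)
  finally show ?thesis
    using C \<delta>(2) by (simp add: nn_integral_cmult excess_def measure_pmf.emeasure_eq_measure ennreal_mult)
qed

text \<open>If the distance stayed above \<epsilon>, every step would cancel at least
  \<open>\<delta> * \<epsilon> / 2\<close> at \<open>y\<close>, which is impossible for a quantity
  that starts at most at 1.\<close>

lemma ex_excess_less:
  fixes p :: "nat \<Rightarrow> 's pmf"
  assumes step: "\<And>n. p (Suc n) = bind_pmf (p n) K" and inv: "bind_pmf r K = r"
    and dom: "\<And>n x. pmf (p n) x \<le> C * pmf r x"
    and pos: "\<And>x. x \<in> set_pmf r \<Longrightarrow> pmf (K x) y > 0" and \<epsilon>: "\<epsilon> > 0"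
  shows "\<exists>n. excess (p n) r < ennreal \<epsilon>"
proof (rule ccontr)
  assume "\<not> ?thesis"
  then have ge: "ennreal \<epsilon> \<le> excess (p n) r" for n by (simp add: not_less)
  \<comment> \<open>One constant has to dominate both \<open>p n\<close> and \<open>r\<close>,
    because the flows in both directions are estimated.\<close>
  define D where "D = max 1 C"
  have D: "D \<ge> 1" "pmf (p n) x \<le> D * pmf r x" "pmf r x \<le> D * pmf r x" for n x
    using order_trans[OF dom[of n x] mult_right_mono[of C D "pmf r x"]] mult_right_mono[of 1 D "pmf r x"]
    by (simp_all add: D_def)
  \<comment> \<open>By \<open>pos\<close> these sets exhaust the support of \<open>r\<close>, so the
    \<open>r\<close>-mass outside them tends to zero.\<close>
  define A where "A k = {x. 1 / real (Suc k) \<le> pmf (K x) y}" for k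
  have "(\<lambda>k. measure_pmf.prob r (- A k)) \<longlonglongrightarrow> measure_pmf.prob r (\<Inter>k. - A k)"
  proof (rule measure_pmf.finite_Lim_measure_decseq)
    show "decseq (\<lambda>k. - A k)"
      unfolding decseq_def A_def by (auto elim!: order_trans[rotated] intro!: frac_le)
  qed auto
  also have "measure_pmf.prob r (\<Inter>k. - A k) = 0"
  proof -
    have "x \<notin> (\<Inter>k. - A k)" if "x \<in> set_pmf r" for x
      using nat_approx_posE[OF pos[OF that]] by (auto simp: A_def intro: less_imp_le)
    then show ?thesis by (subst measure_pmf_zero_iff) auto
  qed
  \<comment> \<open>The threshold makes the loss outside \<open>A k\<close> at most half of
    \<open>\<delta> * \<epsilon>\<close>, so the other half remains as flow.\<close>
  finally obtain k where k: "measure_pmf.prob r (- A k) < \<epsilon> / (2 * D)"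
    using order_tendstoD(2)[of _ 0 sequentially "\<epsilon> / (2 * D)"] D(1) \<epsilon>
    by (fastforce simp: eventually_sequentially)
  define \<delta> where "\<delta> = 1 / real (Suc k)"
  have \<delta>: "\<delta> > 0" "\<And>x. x \<in> A k \<Longrightarrow> \<delta> \<le> pmf (K x) y"
    by (auto simp: \<delta>_def A_def)
  have small: "\<delta> * D * measure_pmf.prob r (- A k) \<le> \<delta> * \<epsilon> / 2"
    using k D(1) \<delta>(1) by (simp add: field_simps)
  have flow: "ennreal (\<delta> * \<epsilon> / 2) \<le> excess_flow q q' K y"
    if "ennreal \<epsilon> \<le> excess q q'" "\<And>x. pmf q x \<le> D * pmf r x" for q q'
  proof -
    have "ennreal (\<delta> * \<epsilon>) \<le> ennreal \<delta> * excess q q'"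
      using that(1) \<delta>(1) \<epsilon> by (simp add: ennreal_mult mult_left_mono)
    also have "\<dots> \<le> excess_flow q q' K y + ennreal (\<delta> * D * measure_pmf.prob r (- A k))"
      using \<delta> D(1) that(2) by (intro excess_le_excess_flow) auto
    also have "\<dots> \<le> excess_flow q q' K y + ennreal (\<delta> * \<epsilon> / 2)"
      using small by (intro add_left_mono ennreal_leI)
    finally have "ennreal (\<delta> * \<epsilon> / 2) + ennreal (\<delta> * \<epsilon> / 2) \<le> ennreal (\<delta> * \<epsilon> / 2) + excess_flow q q' K y"
      using \<delta>(1) \<epsilon> by (simp add: add.commute flip: ennreal_plus)
    then show ?thesis
      by (simp add: ennreal_add_left_cancel_le)
  qed
  have dec: "excess (p (Suc n)) r + ennreal (\<delta> * \<epsilon> / 2) \<le> excess (p n) r" for n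
  proof -
    have "ennreal (\<delta> * \<epsilon> / 2) \<le> min (excess_flow (p n) r K y) (excess_flow r (p n) K y)"
      using flow[OF ge D(2)] flow[of r "p n"] ge[of n] D(3) by (simp add: excess_commute)
    then have "excess (p (Suc n)) r + ennreal (\<delta> * \<epsilon> / 2) \<le>
      excess (bind_pmf (p n) K) (bind_pmf r K) + min (excess_flow (p n) r K y) (excess_flow r (p n) K y)"
      by (simp add: step inv add_left_mono)
    also have "\<dots> \<le> excess (p n) r" by (rule excess_bind_le)
    finally show ?thesis .
  qed
  have "ennreal (real n * (\<delta> * \<epsilon> / 2)) + excess (p n) r \<le> 1" for n
  proof (induction n)
    case 0
    then show ?case by (simp add: excess_le_1)
  next
    case (Suc n)
    have "ennreal (real (Suc n) * (\<delta> * \<epsilon> / 2)) =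
      ennreal (real n * (\<delta> * \<epsilon> / 2)) + ennreal (\<delta> * \<epsilon> / 2)"
      using \<delta>(1) \<epsilon> by (simp add: distrib_right add.commute flip: ennreal_plus)
    then have "ennreal (real (Suc n) * (\<delta> * \<epsilon> / 2)) + excess (p (Suc n)) r =
      ennreal (real n * (\<delta> * \<epsilon> / 2)) + (excess (p (Suc n)) r + ennreal (\<delta> * \<epsilon> / 2))"
      by (simp add: ac_simps)
    also have "\<dots> \<le> ennreal (real n * (\<delta> * \<epsilon> / 2)) + excess (p n) r"
      by (intro add_left_mono dec)
    finally show ?case using Suc by (rule order_trans)
  qed
  then have "ennreal (real n * (\<delta> * \<epsilon> / 2)) \<le> 1" for n
    by (meson add_increasing2 order_trans zero_le order_refl)
  then have "real n * (\<delta> * \<epsilon> / 2) \<le> 1" for n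
    using \<delta>(1) \<epsilon> by simp
  moreover have "0 < \<delta> * \<epsilon> / 2" using \<delta>(1) \<epsilon> by simp
  then obtain n :: nat where "1 < real n * (\<delta> * \<epsilon> / 2)"
    using reals_Archimedean3 by blast
  ultimately show False by (simp add: not_less[symmetric])
qed

context stationary_markov_semigroup
begin

lemma pmf_P_le:
  assumes "pmf \<pi> x > 0" "t \<ge> 0"
  shows "pmf (P t x) y \<le> 1 / pmf \<pi> x * pmf \<pi> y"
  using pmf_bind_ge[of \<pi> x "P t" y] assms by (simp add: bind_\<pi> field_simps)

text \<open>The contraction is applied to the chain at integer times. One good time \<open>n\<close>
  is enough: any further kernel \<open>P (t - real n)\<close> fixes \<pi> and cannot increase the
  distance.\<close>

lemma eventually_excess_P_less:
  assumes x: "pmf \<pi> x > 0" and pos: "\<And>z. z \<in> S \<Longrightarrow> pmf (P 1 z) y > 0" and \<epsilon>: "\<epsilon> > 0"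
  shows "\<forall>\<^sub>F t in at_top. excess (P t x) \<pi> < ennreal \<epsilon>"
proof -
  have xS: "x \<in> S" using x set_\<pi> by (auto simp: pmf_positive_iff)
  have "\<exists>n. excess (P (real n) x) \<pi> < ennreal \<epsilon>"
  proof (rule ex_excess_less)
    show "P (real (Suc n)) x = bind_pmf (P (real n) x) (P 1)" for n
      using P_add[of "real n" 1 x] xS by (simp add: add.commute)
    show "pmf (P (real n) x) z \<le> 1 / pmf \<pi> x * pmf \<pi> z" for n z
      using pmf_P_le[OF x] by simp
  qed (use set_\<pi> pos bind_\<pi> \<epsilon> in auto)
  then obtain n where n: "excess (P (real n) x) \<pi> < ennreal \<epsilon>" by blast
  have "excess (P t x) \<pi> < ennreal \<epsilon>" if "t \<ge> real n" for t
  proof -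
    have "excess (P t x) \<pi> = excess (bind_pmf (P (real n) x) (P (t - real n))) (bind_pmf \<pi> (P (t - real n)))"
      using that xS P_add[of "real n" "t - real n" x] by (simp add: bind_\<pi>)
    also have "\<dots> \<le> excess (P (real n) x) \<pi>" by (rule excess_bind_mono)
    finally show ?thesis using n by simp
  qed
  then show ?thesis by (auto simp: eventually_at_top_linorder)
qed

lemma pmf_P_tendsto:
  assumes x: "pmf \<pi> x > 0" and pos: "\<And>z. z \<in> S \<Longrightarrow> pmf (P 1 z) y > 0"
  shows "((\<lambda>t. pmf (P t x) z) \<longlongrightarrow> pmf \<pi> z) at_top"
proof (rule tendstoI)
  fix \<epsilon> :: real assume \<epsilon>: "\<epsilon> > 0"
  have "dist (pmf (P t x) z) (pmf \<pi> z) < \<epsilon>" if "excess (P t x) \<pi> < ennreal \<epsilon>" for t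
  proof -
    have "ennreal (pmf (P t x) z - pmf \<pi> z) < ennreal \<epsilon>" "ennreal (pmf \<pi> z - pmf (P t x) z) < ennreal \<epsilon>"
      using that pmf_diff_le_excess excess_commute by (metis le_less_trans)+
    then show ?thesis
      using \<epsilon> by (auto simp: ennreal_less_iff dist_real_def abs_if ennreal_lessI dest!: leD[OF ennreal_leI, rotated] split: if_splits)
  qed
  with eventually_excess_P_less[OF assms \<epsilon>]
  show "\<forall>\<^sub>F t in at_top. dist (pmf (P t x) z) (pmf \<pi> z) < \<epsilon>"
    by (rule eventually_mono)
qed

text \<open>Dominated convergence over the counting measure, for a possibly unbounded
  \<open>f\<close>: by \<open>pmf_P_le\<close> the summands are dominated by
  \<open>pmf \<pi> z * f z / pmf \<pi> x\<close>, which is summable because \<open>f\<close> has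
  finite stationary mean.\<close>

lemma nn_integral_P_tendsto:
  fixes f :: "'a \<Rightarrow> real"
  assumes x: "pmf \<pi> x > 0" and pos: "\<And>z. z \<in> S \<Longrightarrow> pmf (P 1 z) y > 0"
    and f: "\<And>z. 0 \<le> f z" "(\<integral>\<^sup>+z. ennreal (f z) \<partial>measure_pmf \<pi>) < \<infinity>"
  shows "((\<lambda>t. \<integral>\<^sup>+z. ennreal (f z) \<partial>measure_pmf (P t x)) \<longlongrightarrow>
    (\<integral>\<^sup>+z. ennreal (f z) \<partial>measure_pmf \<pi>)) at_top"
proof -
  let ?C = "count_space UNIV :: 'a measure"
  define w where "w z = 1 / pmf \<pi> x * (pmf \<pi> z * f z)" for z
  have eq: "(\<integral>\<^sup>+z. ennreal (f z) \<partial>measure_pmf p) = (\<integral>\<^sup>+z. ennreal (pmf p z * f z) \<partial>?C)" for p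
    by (simp add: nn_integral_measure_pmf ennreal_mult f(1))
  have int_\<pi>: "integrable ?C (\<lambda>z. pmf \<pi> z * f z)"
    using f eq[of \<pi>] by (intro integrableI_nonneg) auto
  then have int_w: "integrable ?C w"
    unfolding w_def by simp
  have le: "norm (pmf (P t x) z * f z) \<le> w z" if "t \<ge> 0" for t z
    using mult_right_mono[OF pmf_P_le[OF x that, of z] f(1)[of z]] f(1)[of z] by (simp add: w_def)
  have int_P: "integrable ?C (\<lambda>z. pmf (P t x) z * f z)" if "t \<ge> 0" for t
    by (intro Bochner_Integration.integrable_bound[OF int_w] AE_I2 order_trans[OF le[OF that]]) auto
  have "((\<lambda>t. integral\<^sup>L ?C (\<lambda>z. pmf (P t x) z * f z)) \<longlongrightarrow> integral\<^sup>L ?C (\<lambda>z. pmf \<pi> z * f z)) at_top"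
  proof (rule integral_dominated_convergence_at_top[OF _ _ int_w])
    show "AE z in ?C. ((\<lambda>t. pmf (P t x) z * f z) \<longlongrightarrow> pmf \<pi> z * f z) at_top"
      by (intro AE_I2 tendsto_mult_right pmf_P_tendsto[OF x pos])
    show "\<forall>\<^sub>F t in at_top. AE z in ?C. norm (pmf (P t x) z * f z) \<le> w z"
      using eventually_ge_at_top[of 0] by eventually_elim (use le in auto)
  qed auto
  then have "((\<lambda>t. ennreal (integral\<^sup>L ?C (\<lambda>z. pmf (P t x) z * f z))) \<longlongrightarrow>
    ennreal (integral\<^sup>L ?C (\<lambda>z. pmf \<pi> z * f z))) at_top"
    by (rule tendsto_ennrealI)
  moreover have "\<forall>\<^sub>F t in at_top. ennreal (integral\<^sup>L ?C (\<lambda>z. pmf (P t x) z * f z)) =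
    (\<integral>\<^sup>+z. ennreal (f z) \<partial>measure_pmf (P t x))"
    using eventually_ge_at_top[of 0]
    by eventually_elim (use int_P f(1) in \<open>simp add: eq nn_integral_eq_integral\<close>)
  moreover have "ennreal (integral\<^sup>L ?C (\<lambda>z. pmf \<pi> z * f z)) = (\<integral>\<^sup>+z. ennreal (f z) \<partial>measure_pmf \<pi>)"
    using int_\<pi> f(1) by (simp add: eq nn_integral_eq_integral)
  ultimately show ?thesis
    by (simp add: tendsto_cong)
qed

end

section \<open>From the finite-dimensional distributions to the law at one time\<close>

lemma markov_chain_law:
  fixes X :: "real \<Rightarrow> 'b \<Rightarrow> 's::countable"
  assumes M: "prob_space M" and chain: "markov_chain M S P X"
    and x: "x \<in> S" and init: "AE \<omega> in M. X 0 \<omega> = x"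
    and P: "set_pmf (P t x) \<subseteq> S" and t: "t > 0"
  shows "distr M (count_space UNIV) (X t) = measure_pmf (P t x)"
proof -
  interpret prob_space M by fact
  have meas: "\<And>s. s \<ge> 0 \<Longrightarrow> X s \<in> measurable M (count_space UNIV)"
    and in_S: "\<And>s \<omega>. s \<ge> 0 \<Longrightarrow> \<omega> \<in> space M \<Longrightarrow> X s \<omega> \<in> S"
    and markov: "\<And>n (t :: nat \<Rightarrow> real) x. 0 \<le> t 0 \<Longrightarrow> (\<forall>k\<le>n. t k < t (Suc k)) \<Longrightarrow> (\<forall>k\<le>Suc n. x k \<in> S) \<Longrightarrow>
        measure M {\<omega> \<in> space M. \<forall>k\<le>Suc n. X (t k) \<omega> = x k} =
        measure M {\<omega> \<in> space M. \<forall>k\<le>n. X (t k) \<omega> = x k} *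
          pmf (P (t (Suc n) - t n) (x n)) (x (Suc n))"
    using chain unfolding markov_chain_def by blast+
  have [measurable]: "X 0 \<in> measurable M (count_space UNIV)" "X t \<in> measurable M (count_space UNIV)"
    using meas t by auto
  have marginal: "measure M {\<omega> \<in> space M. X t \<omega> = y} = pmf (P t x) y" for y
  proof (cases "y \<in> S")
    case False
    then have "{\<omega> \<in> space M. X t \<omega> = y} = {}" using in_S[of t] t by auto
    moreover have "pmf (P t x) y = 0" using False P by (auto simp: set_pmf_iff)
    ultimately show ?thesis by (simp only: measure_empty)
  next
    case True
    \<comment> \<open>The Markov property is used with \<open>n = 0\<close>, at the two times 0 and
      \<open>t\<close>; strictly increasing times are the reason for \<open>t > 0\<close>. Values at
      larger indices are never read.\<close>
    define s where "s k = (if k = 0 then 0 else t)" for k :: nat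
    define v where "v k = (if k = 0 then x else y)" for k :: nat
    have "measure M {\<omega> \<in> space M. \<forall>k\<le>Suc 0. X (s k) \<omega> = v k} =
      measure M {\<omega> \<in> space M. \<forall>k\<le>0. X (s k) \<omega> = v k} * pmf (P (s (Suc 0) - s 0) (v 0)) (v (Suc 0))"
      by (rule markov) (use t x True in \<open>auto simp: s_def v_def\<close>)
    then have "measure M {\<omega> \<in> space M. X 0 \<omega> = x \<and> X t \<omega> = y} =
      measure M {\<omega> \<in> space M. X 0 \<omega> = x} * pmf (P t x) y"
      by (simp add: s_def v_def le_Suc_eq all_conj_distrib conj_commute cong: conj_cong)
    moreover have "measure M {\<omega> \<in> space M. X 0 \<omega> = x} = 1"
      using init by (subst prob_Collect_eq_1) auto
    moreover have "measure M {\<omega> \<in> space M. X 0 \<omega> = x \<and> X t \<omega> = y} = measure M {\<omega> \<in> space M. X t \<omega> = y}"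
      using init by (intro measure_eq_AE) auto
    ultimately show ?thesis by simp
  qed
  show ?thesis
  proof (rule measure_eqI_countable[where A=UNIV])
    fix y
    have "emeasure (distr M (count_space UNIV) (X t)) {y} = ennreal (measure M {\<omega> \<in> space M. X t \<omega> = y})"
      by (subst emeasure_distr) (auto simp: emeasure_eq_measure intro!: arg_cong[where f="measure M"])
    then show "emeasure (distr M (count_space UNIV) (X t)) {y} = emeasure (measure_pmf (P t x)) {y}"
      by (simp add: marginal emeasure_pmf_single)
  qed auto
qed

section \<open>Max-Weight matching\<close>

locale max_weight_matching =
  fixes adj :: "'v::finite \<Rightarrow> 'v \<Rightarrow> bool"
    and lam :: "'v \<Rightarrow> real"
    and w :: "'v \<times> 'v \<Rightarrow> real"
    and N :: "'a measure"
    and U :: "'v \<times> 'v \<Rightarrow> 'a \<Rightarrow> real"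
    and B :: real
  assumes graph: "connected_simple_graph adj"
    and rates: "\<And>i. lam i > 0"
    and rewards: "\<And>i j. adj i j \<Longrightarrow> w (j, i) \<ge> 0"
    and errors_space: "prob_space N"
    and errors_measurable: "\<And>i j. adj i j \<Longrightarrow> U (j, i) \<in> borel_measurable N"
    and B_nonneg: "B \<ge> 0"
    and errors_bounded: "\<And>i j. adj i j \<Longrightarrow> AE \<omega> in N. - B \<le> U (j, i) \<omega> \<and> U (j, i) \<omega> \<le> B"
    and stability: "\<And>I. independent_set adj I \<Longrightarrow> sum lam I < sum lam (nbhd adj I)"
begin

interpretation N: prob_space N by (rule errors_space)

abbreviation "L \<equiv> mw_generator adj lam w N U"
abbreviation "S \<equiv> state_space adj"
abbreviation "\<nu> x j i \<equiv> match_prob adj w N U x j i"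

definition match_rate :: "'v state \<Rightarrow> 'v \<Rightarrow> real" where
  "match_rate x i = (\<Sum>j\<in>nbhd adj {i}. lam j * \<nu> x j i)"

lemma mw_generator_eq:
  "L f x = (\<Sum>i\<in>- nbhd adj (supp x). lam i * (f (x(i := x i + 1)) - f x)) +
    (\<Sum>i\<in>supp x. match_rate x i * (f (x(i := x i - 1)) - f x))"
  by (simp add: mw_generator_def match_rate_def)

lemma adj_sym: "adj i j \<longleftrightarrow> adj j i" and adj_irrefl: "\<not> adj i i"
  using graph by (auto simp: connected_simple_graph_def symp_def irreflp_def)

lemma rates_nonneg: "lam i \<ge> 0"
  using rates[of i] by simp

lemma state_space_D: "x \<in> S \<Longrightarrow> 0 < x i \<Longrightarrow> 0 < x j \<Longrightarrow> \<not> adj i j"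
  by (force simp: state_space_def)

lemma nbhd_singleton: "nbhd adj {i} = {j. adj j i}"
  by (simp add: nbhd_def)

lemma mem_nbhd_iff: "j \<in> nbhd adj A \<longleftrightarrow> (\<exists>i\<in>A. adj i j)"
  using adj_sym by (auto simp: nbhd_def)

lemma nbhd_mono: "A \<subseteq> A' \<Longrightarrow> nbhd adj A \<subseteq> nbhd adj A'"
  by (auto simp: nbhd_def)

section \<open>Matching probabilities and jump rates\<close>

definition available :: "'v state \<Rightarrow> 'v \<Rightarrow> 'v set" where
  "available x j = {i. adj i j \<and> 0 < x i}"

lemma available_eq_empty_iff: "available x j = {} \<longleftrightarrow> j \<notin> nbhd adj (supp x)"
  by (auto simp: available_def mem_nbhd_iff supp_def)

lemma mem_best_classes_iff:
  "i \<in> best_classes adj w u x j \<longleftrightarrow>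
    i \<in> available x j \<and> (\<forall>k\<in>available x j. score w u x j k \<le> score w u x j i)"
  by (auto simp: best_classes_def is_arg_max_def available_def nbhd_singleton not_less)

lemma best_classes_nonempty:
  assumes "available x j \<noteq> {}"
  shows "best_classes adj w u x j \<noteq> {}"
proof -
  have "Max (score w u x j ` available x j) \<in> score w u x j ` available x j"
    using assms by (intro Max_in) auto
  then obtain i where i: "i \<in> available x j" "score w u x j i = Max (score w u x j ` available x j)"
    by auto
  have "\<forall>k\<in>available x j. score w u x j k \<le> score w u x j i"
    unfolding i(2) by (auto intro: Max_ge)
  with i(1) have "i \<in> best_classes adj w u x j"
    by (simp add: mem_best_classes_iff)
  then show ?thesis by blast
qed

text \<open>The denominator is the cardinality of the set of maximizers, written so that measurability is
  evident; the quotient is \<open>0 / 0 = 0\<close> if there is no maximizer.\<close>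

definition choice_prob :: "'v state \<Rightarrow> 'v \<Rightarrow> 'v \<Rightarrow> 'a \<Rightarrow> real" where
  "choice_prob x j i \<omega> = of_bool (i \<in> best_classes adj w (\<lambda>e. U e \<omega>) x j) /
    (\<Sum>k\<in>UNIV. of_bool (k \<in> best_classes adj w (\<lambda>e. U e \<omega>) x j))"

lemma match_prob_eq: "\<nu> x j i = (\<integral>\<omega>. choice_prob x j i \<omega> \<partial>N)"
  unfolding match_prob_def choice_prob_def Let_def
  by (intro Bochner_Integration.integral_cong refl) auto

lemma choice_prob_bounds: "0 \<le> choice_prob x j i \<omega>" "choice_prob x j i \<omega> \<le> 1"
proof -
  show "0 \<le> choice_prob x j i \<omega>"
    by (auto simp: choice_prob_def intro!: divide_nonneg_nonneg sum_nonneg)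
  have "card A \<ge> 1" if "i \<in> A" for A :: "'v set"
    using that by (auto simp: Suc_le_eq card_gt_0_iff)
  then show "choice_prob x j i \<omega> \<le> 1"
    by (auto simp: choice_prob_def divide_le_eq)
qed

text \<open>Membership is a finite conjunction of comparisons of scores. All of them involve
  available classes, that is, errors on edges, for which measurability is assumed.\<close>

lemma measurable_mem_best_classes:
  "Measurable.pred N (\<lambda>\<omega>. i \<in> best_classes adj w (\<lambda>e. U e \<omega>) x j)"
proof (cases "i \<in> available x j")
  case True
  have [measurable]: "(\<lambda>\<omega>. score w (\<lambda>e. U e \<omega>) x j k) \<in> borel_measurable N" if "k \<in> available x j" for k
    using that errors_measurable[of k j] unfolding score_def available_def by simp
  show ?thesis
    using True unfolding mem_best_classes_iff by simp
qed (simp add: mem_best_classes_iff)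

lemma measurable_choice_prob: "choice_prob x j i \<in> borel_measurable N"
proof -
  note [measurable] = measurable_mem_best_classes
  show ?thesis unfolding choice_prob_def[abs_def] of_bool_def by measurable
qed

lemma integrable_choice_prob: "integrable N (choice_prob x j i)"
  using measurable_choice_prob choice_prob_bounds
  by (intro N.integrable_const_bound[where B=1]) auto

lemma match_prob_nonneg: "\<nu> x j i \<ge> 0"
  unfolding match_prob_eq by (intro Bochner_Integration.integral_nonneg choice_prob_bounds)

lemma match_prob_unavailable: "i \<notin> available x j \<Longrightarrow> \<nu> x j i = 0"
  by (simp add: match_prob_eq choice_prob_def mem_best_classes_iff)

lemma match_prob_not_nbhd: "j \<notin> nbhd adj (supp x) \<Longrightarrow> \<nu> x j i = 0"
  using available_eq_empty_iff by (intro match_prob_unavailable) auto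

lemma sum_match_prob:
  assumes "j \<in> nbhd adj (supp x)"
  shows "(\<Sum>i\<in>UNIV. \<nu> x j i) = 1"
proof -
  have "(\<Sum>i\<in>UNIV. choice_prob x j i \<omega>) = 1" for \<omega>
  proof -
    have "best_classes adj w (\<lambda>e. U e \<omega>) x j \<noteq> {}"
      using assms available_eq_empty_iff by (intro best_classes_nonempty) auto
    then show ?thesis
      unfolding choice_prob_def sum_divide_distrib[symmetric] by (simp add: card_gt_0_iff)
  qed
  then show ?thesis
    unfolding match_prob_eq
    by (subst Bochner_Integration.integral_sum[symmetric]) (simp_all add: integrable_choice_prob N.prob_space)
qed

lemma reward_le_max: "adj i j \<Longrightarrow> w (j, i) \<le> max_reward adj w"
proof -
  have "finite {w (j, i) |i j. adj i j}"
    by (rule finite_subset[of _ "range w"]) auto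
  then show "adj i j \<Longrightarrow> w (j, i) \<le> max_reward adj w"
    unfolding max_reward_def by (intro Max_ge) auto
qed

text \<open>The largest possible deficit of the matched queue against the longest compatible one:
  errors distort each of the two lengths by at most \<open>B\<close>, and a reward adds between 0
  and \<open>max_reward adj w\<close>.\<close>

abbreviation slack :: real where "slack \<equiv> max_reward adj w + 2 * B"

text \<open>Almost surely the score of \<open>i\<close> is at most
  \<open>x i + B + max_reward adj w\<close>, which is below \<open>x k - B\<close>, and the latter
  is at most the score of \<open>k\<close>.\<close>

lemma match_prob_eq_0:
  assumes k: "adj k j" and lt: "real (x i) + slack < real (x k)"
  shows "\<nu> x j i = 0"
proof (cases "i \<in> available x j")
  case True
  then have i: "adj i j" by (simp add: available_def)
  have "0 < real (x k)"
    using lt reward_le_max[OF k] rewards[OF k] B_nonneg by simp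
  then have k': "k \<in> available x j" using k by (simp add: available_def)
  have "AE \<omega> in N. choice_prob x j i \<omega> = 0"
    using errors_bounded[OF i] errors_bounded[OF k]
  proof eventually_elim
    case (elim \<omega>)
    then have "score w (\<lambda>e. U e \<omega>) x j i < score w (\<lambda>e. U e \<omega>) x j k"
      using lt reward_le_max[OF i] rewards[OF k] B_nonneg by (auto simp: score_def)
    with k' have "i \<notin> best_classes adj w (\<lambda>e. U e \<omega>) x j"
      by (auto simp: mem_best_classes_iff not_le)
    then show ?case by (simp add: choice_prob_def)
  qed
  then show ?thesis unfolding match_prob_eq by (rule integral_eq_zero_AE)
qed (rule match_prob_unavailable)

lemma match_rate_nonneg: "match_rate x i \<ge> 0"
  unfolding match_rate_def by (intro sum_nonneg mult_nonneg_nonneg rates_nonneg match_prob_nonneg)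

text \<open>Changes from the viewpoint of the departing class to that of the arriving class.
  Matching probabilities vanish off the edges and off the support, so both sums extend to all
  classes before they are swapped.\<close>

lemma sum_match_rate:
  "(\<Sum>i\<in>supp x. match_rate x i * g i) =
    (\<Sum>j\<in>nbhd adj (supp x). lam j * (\<Sum>i\<in>UNIV. \<nu> x j i * g i))"
proof -
  have "match_rate x i = (\<Sum>j\<in>UNIV. lam j * \<nu> x j i)" for i
    unfolding match_rate_def
    by (intro sum.mono_neutral_left)
       (auto simp: nbhd_singleton available_def adj_sym intro!: match_prob_unavailable)
  then have "(\<Sum>i\<in>supp x. match_rate x i * g i) = (\<Sum>i\<in>supp x. \<Sum>j\<in>UNIV. lam j * \<nu> x j i * g i)"
    by (simp add: sum_distrib_right)
  also have "\<dots> = (\<Sum>i\<in>UNIV. \<Sum>j\<in>UNIV. lam j * \<nu> x j i * g i)"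
    by (intro sum.mono_neutral_left)
       (auto simp: supp_def available_def intro!: sum.neutral match_prob_unavailable)
  also have "\<dots> = (\<Sum>j\<in>UNIV. \<Sum>i\<in>UNIV. lam j * \<nu> x j i * g i)"
    by (rule sum.swap)
  also have "\<dots> = (\<Sum>j\<in>nbhd adj (supp x). \<Sum>i\<in>UNIV. lam j * \<nu> x j i * g i)"
    by (intro sum.mono_neutral_right) (auto simp: match_prob_not_nbhd)
  finally show ?thesis by (simp add: sum_distrib_left mult.assoc)
qed

text \<open>Every arrival causes exactly one jump, by being stored or by being matched.\<close>

lemma sum_rates: "(\<Sum>i\<in>- nbhd adj (supp x). lam i) + (\<Sum>i\<in>supp x. match_rate x i) = sum lam UNIV"
proof -
  have "(\<Sum>i\<in>supp x. match_rate x i) = sum lam (nbhd adj (supp x))"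
    using sum_match_rate[of x "\<lambda>_. 1"] by (simp add: sum_match_prob)
  moreover have "sum lam UNIV = sum lam (- nbhd adj (supp x)) + sum lam (nbhd adj (supp x))"
    by (subst sum.union_disjoint[symmetric]) (auto simp: Compl_partition2)
  ultimately show ?thesis by simp
qed

text \<open>All jump rates are nonnegative, and only increments from \<open>x\<close> enter. This
  compares the energy with its truncations.\<close>

lemma generator_mono:
  assumes "\<And>y. f y - f x \<le> g y - g x"
  shows "L f x \<le> L g x"
  unfolding mw_generator_eq
  using assms rates match_rate_nonneg by (intro add_mono sum_mono mult_left_mono) (auto simp: rates_nonneg)

text \<open>No jump leads back to \<open>x\<close>, so the left-hand side is the total jump rate,
  known from \<open>sum_rates\<close>.\<close>

lemma exit_rate: "- L (indicator {x}) x \<le> sum lam UNIV"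
proof -
  have up: "x(i := x i + 1) \<noteq> x" for i
    by (metis add_cancel_right_right fun_upd_same one_neq_zero)
  have down: "x(i := x i - 1) \<noteq> x" if "i \<in> supp x" for i
    using that by (auto simp: supp_def fun_eq_iff)
  have "L (indicator {x}) x = - (\<Sum>i\<in>- nbhd adj (supp x). lam i) - (\<Sum>i\<in>supp x. match_rate x i)"
    unfolding mw_generator_eq using up down
    by (simp add: sum_negf indicator_def)
  then show ?thesis using sum_rates[of x] by simp
qed

section \<open>Communication of all states with the empty state\<close>

lemma generator_indicator_up:
  assumes i: "i \<notin> nbhd adj (supp x)" and z: "z = x(i := x i + 1)"
  shows "L (indicator {z}) x > 0"
proof -
  have ne: "x \<noteq> z" using z by (auto simp: fun_eq_iff)
  \<comment> \<open>As \<open>x\<close> differs from \<open>z\<close>, every term of the generator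
    is nonnegative, so the single term of class \<open>i\<close> bounds it from below.\<close>
  have "lam i * (indicator {z} z - indicator {z} x) \<le>
    (\<Sum>k\<in>- nbhd adj (supp x). lam k * (indicator {z} (x(k := x k + 1)) - indicator {z} x))"
    using i rates ne unfolding z
    by (intro member_le_sum[of i _ "\<lambda>k. lam k * (indicator {_} (x(k := x k + 1)) - indicator {_} x)"])
       (auto intro!: mult_nonneg_nonneg simp: rates_nonneg)
  moreover have "0 \<le> (\<Sum>k\<in>supp x. match_rate x k * (indicator {z} (x(k := x k - 1)) - indicator {z} x))"
    using ne match_rate_nonneg by (intro sum_nonneg mult_nonneg_nonneg) auto
  ultimately show ?thesis
    using rates[of i] ne unfolding mw_generator_eq by simp
qed

lemma generator_indicator_down:
  assumes i: "i \<in> supp x" "match_rate x i > 0" and z: "z = x(i := x i - 1)"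
  shows "L (indicator {z}) x > 0"
proof -
  have ne: "x \<noteq> z" using z i by (auto simp: fun_eq_iff supp_def)
  have "match_rate x i * (indicator {z} z - indicator {z} x) \<le>
    (\<Sum>k\<in>supp x. match_rate x k * (indicator {z} (x(k := x k - 1)) - indicator {z} x))"
    using i ne match_rate_nonneg unfolding z
    by (intro member_le_sum[of i _ "\<lambda>k. match_rate x k * (indicator {_} (x(k := x k - 1)) - indicator {_} x)"])
       (auto intro!: mult_nonneg_nonneg)
  moreover have "0 \<le> (\<Sum>k\<in>- nbhd adj (supp x). lam k * (indicator {z} (x(k := x k + 1)) - indicator {z} x))"
    using ne rates by (intro sum_nonneg mult_nonneg_nonneg) (auto simp: rates_nonneg)
  ultimately show ?thesis
    using i(2) ne unfolding mw_generator_eq by simp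
qed

text \<open>Unfolds to exactly the relation in \<open>P_pos_rtrancl\<close>.\<close>

definition jump :: "'v state \<Rightarrow> 'v state \<Rightarrow> bool" where
  "jump x y \<longleftrightarrow> x \<in> S \<and> y \<in> S \<and> x \<noteq> y \<and> L (indicator {y}) x > 0"

lemma state_space_le:
  assumes "x \<in> S" "\<And>i. y i \<le> x i"
  shows "y \<in> S"
proof -
  have "y i * y j = 0" if "adj i j" for i j
  proof -
    have "x i * x j = 0" using that assms(1) by (simp add: state_space_def)
    then show ?thesis
      using mult_le_mono[OF assms(2)[of i] assms(2)[of j]] by (simp only: le_zero_eq)
  qed
  then show ?thesis by (simp add: state_space_def)
qed

lemma sum_decrement_less:
  assumes "x i > (0::nat)"
  shows "sum (x(i := x i - 1)) UNIV < sum x (UNIV :: 'v set)"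
  using assms by (intro sum_strict_mono_ex1) auto

text \<open>Stability of the singleton \<open>{k}\<close> of a nonempty queue forces a neighbour
  \<open>j\<close> of \<open>k\<close>. An arriving \<open>j\<close>-item is surely matched, though
  possibly with a class other than \<open>k\<close>.\<close>

lemma ex_match_rate_pos:
  assumes x: "x \<noteq> (\<lambda>_. 0)"
  shows "\<exists>i\<in>supp x. match_rate x i > 0"
proof -
  obtain k where k: "k \<in> supp x" using x by (auto simp: supp_def fun_eq_iff)
  have "independent_set adj {k}" using adj_irrefl by (simp add: independent_set_def)
  from stability[OF this] have "nbhd adj {k} \<noteq> {}" using rates[of k] by auto
  then obtain j where "j \<in> nbhd adj {k}" by blast
  then have j: "j \<in> nbhd adj (supp x)" using k nbhd_mono[of "{k}" "supp x"] by blast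
  then have "0 < (\<Sum>i\<in>UNIV. \<nu> x j i)" by (simp add: sum_match_prob)
  then obtain i where i: "\<nu> x j i > 0"
    using sum_nonpos[of UNIV "\<nu> x j"] by (force simp: not_less[symmetric])
  then have avail: "i \<in> available x j" using match_prob_unavailable[of i x j] by auto
  have "0 < lam j * \<nu> x j i" using i rates[of j] by simp
  also have "\<dots> \<le> match_rate x i"
    unfolding match_rate_def using avail adj_sym
    by (intro member_le_sum[of j _ "\<lambda>j. lam j * \<nu> x j i"])
       (auto simp: nbhd_singleton available_def match_prob_nonneg rates_nonneg)
  finally show ?thesis using avail by (auto simp: available_def supp_def)
qed

lemma jump_to_empty: "x \<in> S \<Longrightarrow> jump\<^sup>*\<^sup>* x (\<lambda>_. 0)"
proof (induction "sum x UNIV" arbitrary: x rule: less_induct)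
  case less
  show ?case
  proof (cases "x = (\<lambda>_. 0)")
    case False
    then obtain i where i: "i \<in> supp x" "match_rate x i > 0"
      using ex_match_rate_pos by blast
    define y where "y = x(i := x i - 1)"
    have xi: "x i > 0" using i by (simp add: supp_def)
    have y: "y \<in> S" by (rule state_space_le[OF less.prems]) (simp add: y_def)
    have "y \<noteq> x" using xi by (auto simp: y_def fun_eq_iff)
    then have "jump x y"
      using generator_indicator_down[OF i y_def] y less.prems by (simp add: jump_def)
    moreover have "jump\<^sup>*\<^sup>* y (\<lambda>_. 0)"
      using less.hyps[OF _ y] sum_decrement_less[of x i] xi by (simp add: y_def)
    ultimately show ?thesis by (rule converse_rtranclp_into_rtranclp)
  qed simp
qed

text \<open>Items of \<open>x\<close> are stored one at a time. This is possible because the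
  neighbours of a class present in \<open>x\<close> have empty queues throughout.\<close>

lemma jump_from_empty: "x \<in> S \<Longrightarrow> jump\<^sup>*\<^sup>* (\<lambda>_. 0) x"
proof (induction "sum x UNIV" arbitrary: x rule: less_induct)
  case less
  show ?case
  proof (cases "x = (\<lambda>_. 0)")
    case False
    then obtain i where xi: "x i > 0" by (auto simp: fun_eq_iff)
    define y where "y = x(i := x i - 1)"
    have y: "y \<in> S" by (rule state_space_le[OF less.prems]) (simp add: y_def)
    have x_eq: "x = y(i := y i + 1)" using xi by (simp add: y_def)
    have "i \<notin> nbhd adj (supp y)"
    proof
      assume "i \<in> nbhd adj (supp y)"
      then obtain k where k: "adj k i" "y k > 0" by (auto simp: mem_nbhd_iff supp_def)
      then have "x k > 0" by (auto simp: y_def split: if_splits)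
      then show False using state_space_D[OF less.prems _ xi] k(1) by blast
    qed
    moreover have "y \<noteq> x" using xi by (auto simp: y_def fun_eq_iff)
    ultimately have "jump y x"
      using generator_indicator_up[OF _ x_eq] y less.prems by (simp add: jump_def)
    moreover have "jump\<^sup>*\<^sup>* (\<lambda>_. 0) y"
      using less.hyps[OF _ y] sum_decrement_less[of x i] xi by (simp add: y_def)
    ultimately show ?thesis by simp
  qed simp
qed

section \<open>Drift of the quadratic energy\<close>

definition energy :: "'v state \<Rightarrow> real" where
  "energy x = (\<Sum>i\<in>UNIV. (real (x i))\<^sup>2)"

lemma energy_update: "energy (x(i := k)) - energy x = (real k)\<^sup>2 - (real (x i))\<^sup>2"
  unfolding energy_def by (simp add: sum.remove[of UNIV i])

lemma le_sup_norm: "x i \<le> sup_norm x"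
  unfolding sup_norm_def by (intro Max_ge) auto

text \<open>Natural numbers are at most their squares. This is the hypothesis
  \<open>f x \<le> V x\<close> of the drift criterion.\<close>

lemma sup_norm_le_energy: "real (sup_norm x) \<le> energy x"
proof -
  have "sup_norm x \<in> range x" unfolding sup_norm_def by (intro Max_in) auto
  then obtain i where i: "sup_norm x = x i" by auto
  have "real (x i) \<le> (real (x i))\<^sup>2"
    by (cases "x i = 0") (auto simp: power2_eq_square)
  also have "\<dots> \<le> energy x"
    unfolding energy_def by (intro member_le_sum[of i _ "\<lambda>i. (real (x i))\<^sup>2"]) auto
  finally show ?thesis by (simp add: i)
qed

text \<open>A jump changes the square of a queue length \<open>k\<close> by \<open>1 + 2 * k\<close>
  or \<open>1 - 2 * k\<close>; the ones add up to the total jump rate.\<close>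

lemma generator_energy:
  assumes x: "x \<in> S"
  shows "L energy x = sum lam UNIV +
    2 * ((\<Sum>i\<in>UNIV. lam i * real (x i)) - (\<Sum>i\<in>supp x. match_rate x i * real (x i)))"
proof -
  have "L energy x = (\<Sum>i\<in>- nbhd adj (supp x). lam i * (1 + 2 * real (x i))) +
    (\<Sum>i\<in>supp x. match_rate x i * (1 - 2 * real (x i)))"
    unfolding mw_generator_eq
    by (intro arg_cong2[where f="(+)"] sum.cong refl)
       (auto simp: energy_update power2_eq_square algebra_simps supp_def)
  also have "\<dots> = sum lam UNIV +
    2 * ((\<Sum>i\<in>- nbhd adj (supp x). lam i * real (x i)) - (\<Sum>i\<in>supp x. match_rate x i * real (x i)))"
    unfolding sum_rates[of x, symmetric]
    by (simp add: algebra_simps sum.distrib sum_subtractf sum_distrib_left)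
  \<comment> \<open>Queues of classes adjacent to a nonempty queue are empty, so the added terms are
    zero.\<close>
  also have "(\<Sum>i\<in>- nbhd adj (supp x). lam i * real (x i)) = (\<Sum>i\<in>UNIV. lam i * real (x i))"
    using state_space_D[OF x] by (intro sum.mono_neutral_left) (auto simp: mem_nbhd_iff supp_def)
  finally show ?thesis .
qed

definition level :: "'v state \<Rightarrow> nat \<Rightarrow> 'v set" where
  "level x m = {i. m < x i}"

lemma independent_level:
  assumes "x \<in> S" "m < sup_norm x"
  shows "independent_set adj (level x m)"
proof -
  have "sup_norm x \<in> range x" unfolding sup_norm_def by (intro Max_in) auto
  then have "level x m \<noteq> {}" using assms(2) by (auto simp: level_def)
  then show ?thesis
    using state_space_D[OF assms(1)] by (auto simp: independent_set_def level_def)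
qed

lemma stability_gap_le:
  "independent_set adj I \<Longrightarrow> stability_gap adj lam \<le> sum lam (nbhd adj I) - sum lam I"
  unfolding stability_gap_def by (intro Min_le) (auto intro: finite_image_set)

lemma stability_gap_pos: "stability_gap adj lam > 0"
proof -
  have "independent_set adj {undefined}" using adj_irrefl by (simp add: independent_set_def)
  then have "stability_gap adj lam \<in> {sum lam (nbhd adj I) - sum lam I | I. independent_set adj I}"
    unfolding stability_gap_def by (intro Min_in) (auto intro: finite_image_set)
  then show ?thesis using stability by auto
qed

text \<open>Layer-cake formula: \<open>x i\<close> is the number of levels \<open>m\<close> with
  \<open>m < x i\<close>.\<close>

lemma sum_level: "(\<Sum>i\<in>UNIV. lam i * real (x i)) = (\<Sum>m<sup_norm x. sum lam (level x m))"
proof -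
  have "real (x i) = (\<Sum>m<sup_norm x. of_bool (i \<in> level x m))" for i
  proof -
    have "{..<sup_norm x} \<inter> {m. i \<in> level x m} = {..<x i}"
      using le_sup_norm[of x i] by (auto simp: level_def)
    then show ?thesis by simp
  qed
  then have "(\<Sum>i\<in>UNIV. lam i * real (x i)) =
    (\<Sum>i\<in>UNIV. \<Sum>m<sup_norm x. lam i * of_bool (i \<in> level x m))"
    by (simp only: sum_distrib_left)
  also have "\<dots> = (\<Sum>m<sup_norm x. \<Sum>i\<in>UNIV. lam i * of_bool (i \<in> level x m))"
    by (rule sum.swap)
  also have "\<dots> = (\<Sum>m<sup_norm x. sum lam (level x m))"
    by (simp add: of_bool_def if_distrib[of "(*) _"] sum.If_cases)
  finally show ?thesis .
qed

definition longest :: "'v state \<Rightarrow> 'v \<Rightarrow> nat" where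
  "longest x j = Max (x ` {k. adj k j})"

text \<open>The layer-cake idea for arriving classes: \<open>j\<close> is adjacent to the level set
  of \<open>m\<close> only if some compatible queue exceeds \<open>m\<close>, so at most
  \<open>longest x j\<close> levels count.\<close>

lemma sum_nbhd_level:
  "(\<Sum>m<sup_norm x. sum lam (nbhd adj (level x m))) \<le>
    (\<Sum>j\<in>nbhd adj (supp x). lam j * real (longest x j))"
proof -
  have "(\<Sum>m<sup_norm x. sum lam (nbhd adj (level x m))) =
    (\<Sum>m<sup_norm x. \<Sum>j\<in>nbhd adj (supp x). lam j * of_bool (j \<in> nbhd adj (level x m)))"
  proof (rule sum.cong[OF refl])
    fix m
    have "nbhd adj (level x m) \<subseteq> nbhd adj (supp x)"
      by (intro nbhd_mono) (auto simp: level_def supp_def)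
    then have "nbhd adj (supp x) \<inter> nbhd adj (level x m) = nbhd adj (level x m)" by blast
    then show "sum lam (nbhd adj (level x m)) =
      (\<Sum>j\<in>nbhd adj (supp x). lam j * of_bool (j \<in> nbhd adj (level x m)))"
      by (simp add: of_bool_def if_distrib[of "(*) _"] sum.If_cases)
  qed
  also have "\<dots> = (\<Sum>j\<in>nbhd adj (supp x). \<Sum>m<sup_norm x. lam j * of_bool (j \<in> nbhd adj (level x m)))"
    by (rule sum.swap)
  also have "\<dots> \<le> (\<Sum>j\<in>nbhd adj (supp x). lam j * real (longest x j))"
  proof (intro sum_mono)
    fix j
    have "{..<sup_norm x} \<inter> {m. j \<in> nbhd adj (level x m)} \<subseteq> {..<longest x j}"
    proof
      fix m assume "m \<in> {..<sup_norm x} \<inter> {m. j \<in> nbhd adj (level x m)}"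
      then obtain k where "adj k j" "m < x k" by (auto simp: mem_nbhd_iff level_def)
      moreover from this have "x k \<le> longest x j" unfolding longest_def by (intro Max_ge) auto
      ultimately show "m \<in> {..<longest x j}" by simp
    qed
    from card_mono[OF _ this]
    have "(\<Sum>m<sup_norm x. of_bool (j \<in> nbhd adj (level x m))) \<le> real (longest x j)" by simp
    then show "(\<Sum>m<sup_norm x. lam j * of_bool (j \<in> nbhd adj (level x m))) \<le> lam j * real (longest x j)"
      using rates[of j] by (simp add: sum_distrib_left[symmetric] mult_left_mono less_imp_le)
  qed
  finally show ?thesis .
qed

text \<open>The matching probabilities sum to 1 and, by \<open>match_prob_eq_0\<close>, charge only
  queues within \<open>slack\<close> of the longest compatible one.\<close>

lemma longest_le_expected_match:
  assumes "j \<in> nbhd adj (supp x)"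
  shows "real (longest x j) - slack \<le> (\<Sum>i\<in>UNIV. \<nu> x j i * real (x i))"
proof -
  have "{k. adj k j} \<noteq> {}" using assms by (auto simp: mem_nbhd_iff)
  then have "longest x j \<in> x ` {k. adj k j}" unfolding longest_def by (intro Max_in) auto
  then obtain k where k: "adj k j" "longest x j = x k" by auto
  have "real (longest x j) - slack = (\<Sum>i\<in>UNIV. \<nu> x j i * (real (x k) - slack))"
    unfolding sum_distrib_right[symmetric] sum_match_prob[OF assms] k by simp
  also have "\<dots> \<le> (\<Sum>i\<in>UNIV. \<nu> x j i * real (x i))"
  proof (intro sum_mono)
    fix i
    show "\<nu> x j i * (real (x k) - slack) \<le> \<nu> x j i * real (x i)"
      using match_prob_eq_0[OF k(1), of x i] match_prob_nonneg[of x j i]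
      by (cases "real (x i) + slack < real (x k)") (auto intro!: mult_left_mono)
  qed
  finally show ?thesis .
qed

text \<open>The maximal reward is meaningful only if there is an edge; stability of a singleton
  provides one.\<close>

lemma slack_nonneg: "slack \<ge> 0"
proof -
  have "independent_set adj {undefined}" using adj_irrefl by (simp add: independent_set_def)
  from stability[OF this] have "nbhd adj {undefined} \<noteq> {}" using rates[of undefined] by auto
  then obtain j where "adj j undefined" by (auto simp: nbhd_def)
  then show ?thesis using reward_le_max rewards B_nonneg by fastforce
qed

text \<open>Each of the \<open>sup_norm x\<close> level sets contributes at least
  \<open>stability_gap adj lam\<close> to matched minus arriving weight, and the deviation from the
  longest queue costs at most \<open>slack\<close> per arrival.\<close>

lemma drift:
  assumes x: "x \<in> S"
  shows "L energy x \<le> sum lam UNIV * (1 + 2 * slack) - 2 * stability_gap adj lam * real (sup_norm x)"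
proof -
  let ?E = "nbhd adj (supp x)"
  have "(\<Sum>j\<in>?E. lam j * real (longest x j)) - sum lam UNIV * slack \<le>
    (\<Sum>j\<in>?E. lam j * (real (longest x j) - slack))"
  proof -
    have "sum lam ?E * slack \<le> sum lam UNIV * slack"
      using rates slack_nonneg by (intro mult_right_mono sum_mono2) (auto simp: rates_nonneg)
    then show ?thesis by (simp add: right_diff_distrib sum_subtractf sum_distrib_right)
  qed
  also have "\<dots> \<le> (\<Sum>j\<in>?E. lam j * (\<Sum>i\<in>UNIV. \<nu> x j i * real (x i)))"
    using rates by (intro sum_mono mult_left_mono longest_le_expected_match) (auto simp: rates_nonneg)
  also have "\<dots> = (\<Sum>i\<in>supp x. match_rate x i * real (x i))"
    by (rule sum_match_rate[symmetric])
  finally have matched: "(\<Sum>j\<in>?E. lam j * real (longest x j)) - sum lam UNIV * slack \<le>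
    (\<Sum>i\<in>supp x. match_rate x i * real (x i))" .
  have "(\<Sum>m<sup_norm x. sum lam (level x m)) + real (sup_norm x) * stability_gap adj lam =
    (\<Sum>m<sup_norm x. sum lam (level x m) + stability_gap adj lam)"
    by (simp add: sum.distrib)
  also have "\<dots> \<le> (\<Sum>m<sup_norm x. sum lam (nbhd adj (level x m)))"
    using stability_gap_le[OF independent_level[OF x]] by (intro sum_mono) (simp add: algebra_simps)
  also have "\<dots> \<le> (\<Sum>j\<in>?E. lam j * real (longest x j))"
    by (rule sum_nbhd_level)
  finally show ?thesis
    using matched unfolding generator_energy[OF x] sum_level by (simp add: algebra_simps)
qed

text \<open>Below \<open>n\<close> the truncation agrees with the energy at \<open>x\<close> and is
  nowhere larger, so its drift is no larger. From \<open>n\<close> on, \<open>x\<close> maximizes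
  the truncation, and the drift is at most zero.\<close>

lemma truncated_drift:
  assumes x: "x \<in> S"
  shows "L (\<lambda>y. min (energy y) (real n)) x \<le> (if energy x < real n
    then sum lam UNIV * (1 + 2 * slack) - 2 * stability_gap adj lam * real (sup_norm x) else 0)"
proof (cases "energy x < real n")
  case True
  then have "L (\<lambda>y. min (energy y) (real n)) x \<le> L energy x"
    by (intro generator_mono) auto
  with drift[OF x] True show ?thesis by simp
next
  case False
  then have "L (\<lambda>y. min (energy y) (real n)) x \<le> L (\<lambda>_. 0) x"
    by (intro generator_mono) auto
  also have "\<dots> = 0" by (simp add: mw_generator_eq)
  finally show ?thesis using False by simp
qed

end

text \<open>Means are nonnegative integrals in \<open>ennreal\<close>, so convergence is stated
  without presupposing integrability; the second conjunct shows that the limit is finite.\<close>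

theorem corollary3p9:
  fixes adj :: "'v::finite \<Rightarrow> 'v \<Rightarrow> bool"
    and lam :: "'v \<Rightarrow> real"
    and w :: "'v \<times> 'v \<Rightarrow> real"
    and F :: "'v \<times> 'v \<Rightarrow> real \<Rightarrow> real"
    and N :: "'a measure"
    and U :: "'v \<times> 'v \<Rightarrow> 'a \<Rightarrow> real"
    and B :: real
    and P :: "real \<Rightarrow> 'v state \<Rightarrow> 'v state pmf"
    and \<pi> :: "'v state pmf"
    and M :: "'b measure"
    and X :: "real \<Rightarrow> 'b \<Rightarrow> 'v state"
    and x\<^sub>0 :: "'v state"
  assumes graph: "connected_simple_graph adj"
    and rates: "\<And>i. lam i > 0"
    and rewards: "\<And>i j. adj i j \<Longrightarrow> w (j, i) \<ge> 0"
    and errors_space: "prob_space N"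
    and errors_indep: "prob_space.indep_vars N (\<lambda>_. borel) U {(j, i). adj i j}"
    and errors_cdf: "\<And>i j. adj i j \<Longrightarrow> cdf (distr N borel (U (j, i))) = F (j, i)"
    and B_nonneg: "B \<ge> 0"
    and errors_bounded:
      "\<And>i j. adj i j \<Longrightarrow> measure N {\<omega> \<in> space N. - B \<le> U (j, i) \<omega> \<and> U (j, i) \<omega> \<le> B} = 1"
    and stability:
      "\<And>I. independent_set adj I \<Longrightarrow> sum lam I < sum lam (nbhd adj I)"
    and semigroup: "transition_semigroup (state_space adj) (mw_generator adj lam w N U) P"
    and invariant: "invariant_distribution (state_space adj) P \<pi>"
    and process_space: "prob_space M"
    and process: "markov_chain M (state_space adj) P X"
    and initial_state: "x\<^sub>0 \<in> state_space adj"
    and initial: "AE \<omega> in M. X 0 \<omega> = x\<^sub>0"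
  shows "((\<lambda>t. \<integral>\<^sup>+ \<omega>. ennreal (real (sup_norm (X t \<omega>))) \<partial>M) \<longlongrightarrow>
            (\<integral>\<^sup>+ x. ennreal (real (sup_norm x)) \<partial>measure_pmf \<pi>)) at_top
       \<and> (\<integral>\<^sup>+ x. ennreal (real (sup_norm x)) \<partial>measure_pmf \<pi>)
           \<le> ennreal (sum lam UNIV / stability_gap adj lam *
               (1 / 2 + (max_reward adj w + 2 * B) * real CARD('v)))"
proof -
  interpret N: prob_space N by (rule errors_space)
  have U: "U (j, i) \<in> borel_measurable N" if "adj i j" for i j
    using errors_indep that unfolding N.indep_vars_def by auto
  interpret max_weight_matching adj lam w N U B
  proof
    show "AE \<omega> in N. - B \<le> U (j, i) \<omega> \<and> U (j, i) \<omega> \<le> B" if "adj i j" for i j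
      using errors_bounded[OF that] U[OF that] by (subst (asm) N.prob_Collect_eq_1) auto
  qed (use graph rates rewards B_nonneg stability U in auto)
  interpret stationary_markov_semigroup "state_space adj" "mw_generator adj lam w N U" P "sum lam UNIV" \<pi>
    using semigroup exit_rate invariant by unfold_locales auto
  let ?mean = "\<integral>\<^sup>+ x. ennreal (real (sup_norm x)) \<partial>measure_pmf \<pi>"
  let ?\<eta> = "stability_gap adj lam"
  have \<Lambda>: "sum lam UNIV > 0" using rates by (intro sum_pos) auto
  have "?mean \<le> ennreal (sum lam UNIV * (1 + 2 * slack) / (2 * ?\<eta>))"
  proof (rule expectation_le_of_drift)
    show "L (\<lambda>y. min (energy y) (real n)) x \<le> (if energy x < real n
      then sum lam UNIV * (1 + 2 * slack) - 2 * ?\<eta> * real (sup_norm x) else 0)"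
      if "x \<in> state_space adj" for n x
      using truncated_drift[OF that] .
  qed (use sup_norm_le_energy stability_gap_pos \<Lambda> slack_nonneg in \<open>auto simp: energy_def intro!: sum_nonneg\<close>)
  also have "sum lam UNIV * (1 + 2 * slack) / (2 * ?\<eta>) = sum lam UNIV / ?\<eta> * (1 / 2 + slack)"
    using stability_gap_pos by (simp add: field_simps)
  \<comment> \<open>The drift yields the bound with \<open>slack\<close> alone; as there is at least
    one class, the factor \<open>CARD('v)\<close> only enlarges it.\<close>
  also have "ennreal \<dots> \<le> ennreal (sum lam UNIV / ?\<eta> * (1 / 2 + slack * real CARD('v)))"
  proof -
    have "slack * 1 \<le> slack * real CARD('v)"
      using slack_nonneg by (intro mult_left_mono) (auto simp: Suc_le_eq)
    then show ?thesis
      using \<Lambda> stability_gap_pos by (intro ennreal_leI mult_left_mono) auto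
  qed
  finally have bound: "?mean \<le> ennreal (sum lam UNIV / ?\<eta> * (1 / 2 + slack * real CARD('v)))" .
  have empty: "(\<lambda>_. 0) \<in> state_space adj" by (simp add: state_space_def)
  \<comment> \<open>The empty state is the state \<open>y\<close> at which mass is cancelled in the
    convergence argument.\<close>
  have to_empty: "pmf (P 1 x) (\<lambda>_. 0) > 0" if "x \<in> state_space adj" for x
    using P_pos_rtrancl[OF jump_to_empty[OF that, unfolded jump_def[abs_def]] that] by simp
  have from_empty: "pmf (P 1 (\<lambda>_. 0)) x\<^sub>0 > 0"
    using P_pos_rtrancl[OF jump_from_empty[OF initial_state, unfolded jump_def[abs_def]] empty] by simp
  \<comment> \<open>Invariance at time 1 carries positive mass from a state in the support of \<pi>
    to the empty state, and from there to \<open>x\<^sub>0\<close>; the domination by \<pi> divides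
    by \<open>pmf \<pi> x\<^sub>0\<close>.\<close>
  obtain x where x: "x \<in> set_pmf \<pi>" using set_pmf_not_empty[of \<pi>] by auto
  have "0 < pmf \<pi> x * pmf (P 1 x) (\<lambda>_. 0)"
    using x to_empty set_\<pi> by (auto simp: pmf_positive_iff)
  also have "\<dots> \<le> pmf \<pi> (\<lambda>_. 0)" using pmf_bind_ge[of \<pi> x "P 1"] by (simp add: bind_\<pi>)
  finally have "0 < pmf \<pi> (\<lambda>_. 0) * pmf (P 1 (\<lambda>_. 0)) x\<^sub>0" using from_empty by simp
  also have "\<dots> \<le> pmf \<pi> x\<^sub>0" using pmf_bind_ge[of \<pi> "\<lambda>_. 0" "P 1"] by (simp add: bind_\<pi>)
  finally have pos: "pmf \<pi> x\<^sub>0 > 0" .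
  have "((\<lambda>t. \<integral>\<^sup>+x. ennreal (real (sup_norm x)) \<partial>measure_pmf (P t x\<^sub>0)) \<longlongrightarrow> ?mean) at_top"
    using bound by (intro nn_integral_P_tendsto[OF pos to_empty]) (auto simp: le_less_trans)
  moreover have "\<forall>\<^sub>F t in at_top. (\<integral>\<^sup>+x. ennreal (real (sup_norm x)) \<partial>measure_pmf (P t x\<^sub>0)) =
    (\<integral>\<^sup>+ \<omega>. ennreal (real (sup_norm (X t \<omega>))) \<partial>M)"
    using eventually_gt_at_top[of 0]
  proof eventually_elim
    case (elim t)
    have "X t \<in> measurable M (count_space UNIV)"
      using process elim by (simp add: markov_chain_def)
    moreover have "distr M (count_space UNIV) (X t) = measure_pmf (P t x\<^sub>0)"
      using markov_chain_law[OF process_space process initial_state initial P_in[OF _ initial_state] elim] elim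
      by simp
    ultimately show ?case
      by (simp add: nn_integral_distr flip: \<open>distr M (count_space UNIV) (X t) = _\<close>)
  qed
  ultimately show ?thesis
    using bound by (simp add: tendsto_cong)
qed

end
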